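(* Let $X$ be a dual Banach space with the Radon–Nikodym property, and let $1\le p<\infty$. Then for every $f\in H_{w^*}^{p}[X]$ with $f\ge 0$ and $\|f\|_p\le 1$ there exists $g\in \mathrm{FBL}^{(p)}[X]$ with $g\ge0$ and $\|g\|_p\le 1$ such that $f\le g$. As a consequence, $H_{w^*}^{p}[X]=I_{w^*}^{p}[X]$.
   Context: All Banach spaces are real. Let $1/p+1/p'=1$. For $z_1,\dots,z_n$ in a Banach space, $\|(z_i)_{i=1}^n\|_{p,\mathrm{weak}}=\sup\{\|\sum_i\alpha_i z_i\| : \|(\alpha_i)_i\|_{\ell_{p'}}\le 1\}$. For a Banach space $X$, $H_{w^*}[X]$ is the vector lattice (pointwise operations and order) of positively homogeneous functions $f:X^*\to\mathbb R$ that are weak$^*$-continuous on bounded sets. For $f\in H_{w^*}[X]$, $\|f\|_p$ is the infimum of all $C\ge 0$ such that $(\sum_{i=1}^n|f(x_i^* )|^p)^{1/p}\le C\|(x_i^* )_{i=1}^n\|_{p,\mathrm{weak}}$ for all $n$ and all $x_1^*,\dots,x_n^*\in X^*$. $H_{w^*}^p[X]=\{f\in H_{w^*}[X]:\|f\|_p<\infty\}$, normed by $\|\cdot\|_p$. For $x\in X$, $\delta_x(x^* )=\langle x^*,x\rangle$. $\mathrm{FVL}[X]$ is the vector sublattice of $H_{w^*}[X]$ generated by $\{\delta_x:x\in X\}$; $\mathrm{FBL}^{(p)}[X]$ (the free $p$-convex Banach lattice on $X$) is the closure of $\mathrm{FVL}[X]$ in $H_{w^*}^p[X]$; $I_{w^*}^p[X]$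 is the (order) ideal of $H_{w^*}[X]$ generated by $\mathrm{FBL}^{(p)}[X]$. *)

theory Defs
  imports "HOL-Analysis.Analysis"
begin

section \<open>Dual spaces and the Radon--Nikodym property\<close>

text \<open>The dual of \<open>'a\<close> is the type \<open>'a \<Rightarrow>\<^sub>L real\<close> with the operator norm; a dual Banach space is
  one that is isometrically isomorphic to some \<open>'b \<Rightarrow>\<^sub>L real\<close>.\<close>

definition isometric_isomorphism :: "('a::real_normed_vector \<Rightarrow> 'b::real_normed_vector) \<Rightarrow> bool" where
  "isometric_isomorphism J \<longleftrightarrow> linear J \<and> surj J \<and> (\<forall>x. norm (J x) = norm x)"

text \<open>The library's \<open>has_bochner_integral\<close> requires a second countable range. This version is for
  arbitrary Banach spaces, where Borel measurability has to be replaced by strong measurability,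
  that is, almost everywhere approximability by simple functions.\<close>

definition has_strong_bochner_integral ::
  "'w measure \<Rightarrow> ('w \<Rightarrow> 'a::banach) \<Rightarrow> 'a \<Rightarrow> bool" where
  "has_strong_bochner_integral M f I \<longleftrightarrow>
    (\<exists>s. (\<forall>i. Bochner_Integration.simple_bochner_integrable M (s i)) \<and>
         (AE w in M. (\<lambda>i. s i w) \<longlonglongrightarrow> f w) \<and>
         (\<lambda>i. \<integral>\<^sup>+w. ennreal (norm (f w - s i w)) \<partial>M) \<longlonglongrightarrow> 0 \<and>
         (\<lambda>i. Bochner_Integration.simple_bochner_integral M (s i)) \<longlonglongrightarrow> I)"

definition vector_measure :: "'w measure \<Rightarrow> ('w set \<Rightarrow> 'a::banach) \<Rightarrow> bool" where
  "vector_measure M F \<longleftrightarrow>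
    (\<forall>A :: nat \<Rightarrow> 'w set. range A \<subseteq> sets M \<longrightarrow> disjoint_family A \<longrightarrow>
      (\<lambda>i. F (A i)) sums F (\<Union>i. A i))"

definition bounded_variation :: "'w measure \<Rightarrow> ('w set \<Rightarrow> 'a::banach) \<Rightarrow> bool" where
  "bounded_variation M F \<longleftrightarrow>
    (\<exists>C. \<forall>P. finite P \<longrightarrow> P \<subseteq> sets M \<longrightarrow> disjoint P \<longrightarrow> (\<Sum>A\<in>P. norm (F A)) \<le> C)"

definition radon_nikodym_wrt :: "'w measure \<Rightarrow> 'a::banach itself \<Rightarrow> bool" where
  "radon_nikodym_wrt M (_ :: 'a itself) \<longleftrightarrow>
    (\<forall>F :: 'w set \<Rightarrow> 'a.
      vector_measure M F \<longrightarrow> bounded_variation M F \<longrightarrow> (\<forall>A\<in>null_sets M. F A = 0) \<longrightarrow>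
      (\<exists>g. \<forall>A\<in>sets M. has_strong_bochner_integral M (\<lambda>w. indicator A w *\<^sub>R g w) (F A)))"

text \<open>A definition cannot quantify over all types carrying measures, so the finite measure spaces
  are taken with underlying set a subset of the type \<open>'a\<close> (and an arbitrary sigma-algebra and
  finite measure). Nothing is lost: if \<open>'a\<close> is nontrivial it contains a copy of the unit
  interval, and Lebesgue measure there already characterizes the property; the zero space has
  the property anyway.\<close>

definition radon_nikodym_property :: "'a::banach itself \<Rightarrow> bool" where
  "radon_nikodym_property (_ :: 'a itself) \<longleftrightarrow>
    (\<forall>M :: 'a measure. finite_measure M \<longrightarrow> radon_nikodym_wrt M TYPE('a))"

section \<open>Weak p-norms\<close>

definition conjugate_exponent :: "real \<Rightarrow> ereal" where
  "conjugate_exponent p = (if p = 1 then \<infinity> else ereal (p / (p - 1)))"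

definition lp_norm :: "ereal \<Rightarrow> nat \<Rightarrow> (nat \<Rightarrow> real) \<Rightarrow> real" where
  "lp_norm q n a =
    (if q = \<infinity> then Max (insert 0 ((\<lambda>i. \<bar>a i\<bar>) ` {..<n}))
     else (\<Sum>i<n. \<bar>a i\<bar> powr real_of_ereal q) powr (1 / real_of_ereal q))"

definition weak_norm :: "real \<Rightarrow> nat \<Rightarrow> (nat \<Rightarrow> 'z::real_normed_vector) \<Rightarrow> real" where
  "weak_norm p n z =
    Sup {norm (\<Sum>i<n. a i *\<^sub>R z i) | a. lp_norm (conjugate_exponent p) n a \<le> 1}"

section \<open>Spaces of positively homogeneous functions on the dual\<close>

text \<open>For functionals, the strong operator topology is the topology of pointwise convergence.\<close>

abbreviation weak_star_topology :: "('a::real_normed_vector \<Rightarrow>\<^sub>L real) topology" where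
  "weak_star_topology \<equiv> strong_operator_topology"

definition Hw :: "(('a::banach \<Rightarrow>\<^sub>L real) \<Rightarrow> real) set" where
  "Hw = {f. (\<forall>c \<phi>. 0 \<le> c \<longrightarrow> f (c *\<^sub>R \<phi>) = c * f \<phi>) \<and>
            (\<forall>B. bounded B \<longrightarrow>
              continuous_map (subtopology weak_star_topology B) euclideanreal f)}"

definition p_norm :: "real \<Rightarrow> (('a::banach \<Rightarrow>\<^sub>L real) \<Rightarrow> real) \<Rightarrow> ennreal" where
  "p_norm p f = Inf {ennreal C | C. 0 \<le> C \<and>
    (\<forall>n (\<phi> :: nat \<Rightarrow> 'a \<Rightarrow>\<^sub>L real).
      (\<Sum>i<n. \<bar>f (\<phi> i)\<bar> powr p) powr (1 / p) \<le> C * weak_norm p n \<phi>)}"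

definition Hwp :: "real \<Rightarrow> (('a::banach \<Rightarrow>\<^sub>L real) \<Rightarrow> real) set" where
  "Hwp p = {f \<in> Hw. p_norm p f < \<infinity>}"

definition evaluation :: "'a::banach \<Rightarrow> ('a \<Rightarrow>\<^sub>L real) \<Rightarrow> real" where
  "evaluation x = (\<lambda>\<phi>. blinfun_apply \<phi> x)"

definition function_subspace :: "('b \<Rightarrow> real) set \<Rightarrow> bool" where
  "function_subspace S \<longleftrightarrow> (\<lambda>_. 0) \<in> S \<and>
    (\<forall>f\<in>S. \<forall>g\<in>S. (\<lambda>t. f t + g t) \<in> S) \<and> (\<forall>c. \<forall>f\<in>S. (\<lambda>t. c * f t) \<in> S)"

definition vector_sublattice :: "('b \<Rightarrow> real) set \<Rightarrow> ('b \<Rightarrow> real) set \<Rightarrow> bool" where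
  "vector_sublattice E S \<longleftrightarrow> S \<subseteq> E \<and> function_subspace S \<and>
    (\<forall>f\<in>S. \<forall>g\<in>S. (\<lambda>t. max (f t) (g t)) \<in> S \<and> (\<lambda>t. min (f t) (g t)) \<in> S)"

definition order_ideal :: "('b \<Rightarrow> real) set \<Rightarrow> ('b \<Rightarrow> real) set \<Rightarrow> bool" where
  "order_ideal E S \<longleftrightarrow> S \<subseteq> E \<and> function_subspace S \<and>
    (\<forall>f\<in>E. \<forall>g\<in>S. (\<forall>t. \<bar>f t\<bar> \<le> \<bar>g t\<bar>) \<longrightarrow> f \<in> S)"

definition FVL :: "(('a::banach \<Rightarrow>\<^sub>L real) \<Rightarrow> real) set" where
  "FVL = \<Inter>{S. vector_sublattice Hw S \<and> range evaluation \<subseteq> S}"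

definition FBL :: "real \<Rightarrow> (('a::banach \<Rightarrow>\<^sub>L real) \<Rightarrow> real) set" where
  "FBL p = {f \<in> Hwp p. \<forall>e>0. \<exists>h\<in>FVL. p_norm p (\<lambda>\<phi>. f \<phi> - h \<phi>) < e}"

definition Iwp :: "real \<Rightarrow> (('a::banach \<Rightarrow>\<^sub>L real) \<Rightarrow> real) set" where
  "Iwp p = \<Inter>{S. order_ideal Hw S \<and> FBL p \<subseteq> S}"

end

theory Submission
  imports Defs
begin

text \<open>Let \<open>X\<close> be the dual of \<open>Y\<close>. Since \<open>f\<close> has \<open>p\<close>-norm at most \<open>1\<close>, Pietsch's separation argument
  applied to the elements of \<open>Y\<close> gives a probability measure on the unit ball of \<open>X\<close> such that
  \<open>f(y)\<^sup>p\<close> is at most the integral of \<open>|\<langle>x, y\<rangle>|\<^sup>p\<close>. It is first only finitely additive; on the Stone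
  space it becomes countably additive, and it is pushed to the ball by taking weak-star limits of
  ultrafilters. The Radon--Nikodym property turns the coordinate map of the ball into a strongly
  measurable \<open>h\<close> of norm at most \<open>1\<close> having, for each \<open>y\<close>, almost everywhere the same
  pairing with \<open>y\<close>. The function \<open>g\<close> sending \<open>\<psi>\<close> to the \<open>L\<^sub>p\<close>-norm of \<open>\<psi> \<circ> h\<close> is approximated by finite \<open>p\<close>-sums of evaluations, so it lies in the free
  lattice. It dominates \<open>f\<close> on \<open>Y\<close>, hence on the bidual, because the ball of \<open>Y\<close> is weak-star dense there
  and both functions are weak-star continuous on bounded sets.\<close>

section \<open>Inequalities for p-sums\<close>

text \<open>Separation and compactness are carried out among finitely additive set functions on all
  subsets of \<open>X\<close>, because there compactness is Tychonoff's theorem and every condition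
  involves finitely many values at a time. Separation happens in the predual because the weak p-norm
  of elements of \<open>Y\<close>, viewed in the dual of \<open>X\<close>, is a supremum over points
  of the ball of \<open>X\<close>, so only point masses have to be tested. The measure has to end up
  on \<open>X\<close> itself: the Radon--Nikodym property is applied to the vector measure whose
  value at \<open>A\<close> is the weak-star integral of the identity over \<open>A\<close>. Its
  density need not be the identity, as the two agree against one \<open>y\<close> at a time, off a
  null set depending on \<open>y\<close>. This is harmless, because each inequality to be kept
  involves a single \<open>y\<close>; what is gained is approximation in norm by simple
  functions.\<close>

lemma powr_convex_combination:
  fixes p x y a b :: real
  assumes "1 \<le> p" "0 \<le> x" "0 \<le> y" "0 \<le> a" "0 \<le> b" "a + b = 1"
  shows "(a * x + b * y) powr p \<le> a * x powr p + b * y powr p"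
proof -
  have le: "c powr p \<le> c" if "0 \<le> c" "c \<le> 1" for c :: real
    using powr_mono'[of 1 p c] that assms(1) by simp
  consider "x = 0" | "y = 0" | "0 < x" "0 < y" using assms by linarith
  then show ?thesis
  proof cases
    case 1
    then show ?thesis using assms le[of b] by (auto simp: powr_mult intro!: mult_right_mono)
  next
    case 2
    then show ?thesis using assms le[of a] by (auto simp: powr_mult intro!: mult_right_mono)
  next
    case 3
    have "a = 1 - b" using assms by simp
    with convex_onD[OF powr_convex[OF assms(1)], of b x y] 3 assms show ?thesis by simp
  qed
qed

text \<open>Convexity applied to \<open>\<bar>a\<bar> / A\<close> and
  \<open>\<bar>b\<bar> / B\<close> with weights proportional to \<open>A\<close> and
  \<open>B\<close>. The bound is linear in the two p-th powers, so the same pointwise inequality can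
  be summed or integrated; with \<open>A\<close> and \<open>B\<close> close to the two norms it
  yields Minkowski's inequality in both settings.\<close>

lemma powr_add_le_weighted:
  fixes p A B a b :: real
  assumes "1 \<le> p" "0 < A" "0 < B"
  shows "\<bar>a + b\<bar> powr p \<le>
    (A + B) powr (p - 1) * (A powr (1 - p) * \<bar>a\<bar> powr p + B powr (1 - p) * \<bar>b\<bar> powr p)"
proof -
  define \<alpha> \<beta> where "\<alpha> = A / (A + B)" and "\<beta> = B / (A + B)"
  have ab: "0 \<le> \<alpha>" "0 \<le> \<beta>" "\<alpha> + \<beta> = 1"
    using assms by (auto simp: \<alpha>_def \<beta>_def divide_simps)
  have "\<bar>a + b\<bar> \<le> \<bar>a\<bar> + \<bar>b\<bar>" by simp
  also have "\<dots> = (A + B) * (\<alpha> * (\<bar>a\<bar> / A) + \<beta> * (\<bar>b\<bar> / B))"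
    using assms by (simp add: \<alpha>_def \<beta>_def divide_simps)
  finally have "\<bar>a + b\<bar> powr p \<le> ((A + B) * (\<alpha> * (\<bar>a\<bar> / A) + \<beta> * (\<bar>b\<bar> / B))) powr p"
    using assms by (intro powr_mono2) auto
  also have "\<dots> = (A + B) powr p * (\<alpha> * (\<bar>a\<bar> / A) + \<beta> * (\<bar>b\<bar> / B)) powr p"
    using assms ab by (simp add: powr_mult)
  also have "\<dots> \<le> (A + B) powr p * (\<alpha> * (\<bar>a\<bar> / A) powr p + \<beta> * (\<bar>b\<bar> / B) powr p)"
    using assms ab by (intro mult_left_mono powr_convex_combination) auto
  also have "\<dots> = (A + B) powr (p - 1) * (A powr (1 - p) * \<bar>a\<bar> powr p + B powr (1 - p) * \<bar>b\<bar> powr p)"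
  proof -
    define S where "S = A + B"
    have "0 < S" using assms by (simp add: S_def)
    then show ?thesis
      using assms by (simp add: \<alpha>_def \<beta>_def powr_divide powr_diff field_simps flip: S_def)
  qed
  finally show ?thesis .
qed

lemma powr_weights:
  fixes p A B :: real
  assumes "0 < A" "0 < B"
  shows "(A + B) powr (p - 1) * (A powr (1 - p) * A powr p + B powr (1 - p) * B powr p) = (A + B) powr p"
  using assms by (simp add: powr_diff field_simps)

lemma powr_inverse_le_iff:
  fixes p x C :: real
  assumes "1 \<le> p" "0 \<le> x" "0 \<le> C"
  shows "x powr (1 / p) \<le> C \<longleftrightarrow> x \<le> C powr p"
proof
  assume "x powr (1 / p) \<le> C"
  then have "(x powr (1 / p)) powr p \<le> C powr p" using assms by (intro powr_mono2) auto
  then show "x \<le> C powr p" using assms by (simp add: powr_powr)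
next
  assume "x \<le> C powr p"
  then have "x powr (1 / p) \<le> (C powr p) powr (1 / p)" using assms by (intro powr_mono2) auto
  then show "x powr (1 / p) \<le> C" using assms by (simp add: powr_powr)
qed

lemma sum_powr_triangle:
  fixes a b :: "'i \<Rightarrow> real"
  assumes p: "1 \<le> p"
  shows "(\<Sum>i\<in>I. \<bar>a i + b i\<bar> powr p) powr (1 / p) \<le>
    (\<Sum>i\<in>I. \<bar>a i\<bar> powr p) powr (1 / p) + (\<Sum>i\<in>I. \<bar>b i\<bar> powr p) powr (1 / p)"
    (is "?L \<le> ?A + ?B")
proof (rule field_le_epsilon)
  fix e :: real assume e: "0 < e"
  \<comment> \<open>The extra \<open>e / 2\<close> keeps both weights positive, since the weighted
    inequality divides by them.\<close>
  define A B where "A = ?A + e / 2" and "B = ?B + e / 2"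
  have AB: "0 < A" "0 < B" using e by (auto simp: A_def B_def add_nonneg_pos)
  have A: "(\<Sum>i\<in>I. \<bar>a i\<bar> powr p) \<le> A powr p"
    using powr_inverse_le_iff[OF p, of "\<Sum>i\<in>I. \<bar>a i\<bar> powr p" A] AB e by (simp add: sum_nonneg A_def)
  have B: "(\<Sum>i\<in>I. \<bar>b i\<bar> powr p) \<le> B powr p"
    using powr_inverse_le_iff[OF p, of "\<Sum>i\<in>I. \<bar>b i\<bar> powr p" B] AB e by (simp add: sum_nonneg B_def)
  have "(\<Sum>i\<in>I. \<bar>a i + b i\<bar> powr p) \<le>
     (\<Sum>i\<in>I. (A + B) powr (p - 1) * (A powr (1 - p) * \<bar>a i\<bar> powr p + B powr (1 - p) * \<bar>b i\<bar> powr p))"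
    by (intro sum_mono powr_add_le_weighted p AB)
  also have "\<dots> = (A + B) powr (p - 1) *
      (A powr (1 - p) * (\<Sum>i\<in>I. \<bar>a i\<bar> powr p) + B powr (1 - p) * (\<Sum>i\<in>I. \<bar>b i\<bar> powr p))"
    by (simp add: sum.distrib flip: sum_distrib_left)
  also have "\<dots> \<le> (A + B) powr (p - 1) * (A powr (1 - p) * A powr p + B powr (1 - p) * B powr p)"
    using A B by (intro mult_left_mono add_mono) auto
  also have "\<dots> = (A + B) powr p" by (rule powr_weights[OF AB])
  finally have "?L \<le> A + B"
    using AB p by (subst powr_inverse_le_iff) (auto simp: sum_nonneg)
  then show "?L \<le> ?A + ?B + e" by (simp add: A_def B_def)
qed

lemma integral_powr_triangle:
  fixes a b :: "'w \<Rightarrow> real"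
  assumes p: "1 \<le> p"
    and a: "integrable M (\<lambda>w. \<bar>a w\<bar> powr p)"
    and b: "integrable M (\<lambda>w. \<bar>b w\<bar> powr p)"
    and ab: "integrable M (\<lambda>w. \<bar>a w + b w\<bar> powr p)"
  shows "(\<integral>w. \<bar>a w + b w\<bar> powr p \<partial>M) powr (1 / p) \<le>
    (\<integral>w. \<bar>a w\<bar> powr p \<partial>M) powr (1 / p) + (\<integral>w. \<bar>b w\<bar> powr p \<partial>M) powr (1 / p)"
    (is "?L \<le> ?A + ?B")
proof (rule field_le_epsilon)
  fix e :: real assume e: "0 < e"
  define A B where "A = ?A + e / 2" and "B = ?B + e / 2"
  have AB: "0 < A" "0 < B" using e by (auto simp: A_def B_def add_nonneg_pos)
  have A: "(\<integral>w. \<bar>a w\<bar> powr p \<partial>M) \<le> A powr p"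
    using powr_inverse_le_iff[OF p, of "\<integral>w. \<bar>a w\<bar> powr p \<partial>M" A] AB e by (simp add: A_def)
  have B: "(\<integral>w. \<bar>b w\<bar> powr p \<partial>M) \<le> B powr p"
    using powr_inverse_le_iff[OF p, of "\<integral>w. \<bar>b w\<bar> powr p \<partial>M" B] AB e by (simp add: B_def)
  have "(\<integral>w. \<bar>a w + b w\<bar> powr p \<partial>M) \<le>
     (\<integral>w. (A + B) powr (p - 1) * (A powr (1 - p) * \<bar>a w\<bar> powr p + B powr (1 - p) * \<bar>b w\<bar> powr p) \<partial>M)"
    using a b ab by (intro integral_mono powr_add_le_weighted p AB) auto
  also have "\<dots> = (A + B) powr (p - 1) *
      (A powr (1 - p) * (\<integral>w. \<bar>a w\<bar> powr p \<partial>M) + B powr (1 - p) * (\<integral>w. \<bar>b w\<bar> powr p \<partial>M))"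
    using a b by simp
  also have "\<dots> \<le> (A + B) powr (p - 1) * (A powr (1 - p) * A powr p + B powr (1 - p) * B powr p)"
    using A B by (intro mult_left_mono add_mono) auto
  also have "\<dots> = (A + B) powr p" by (rule powr_weights[OF AB])
  finally have "?L \<le> A + B"
    using AB p by (subst powr_inverse_le_iff) auto
  then show "?L \<le> ?A + ?B + e" by (simp add: A_def B_def)
qed

lemma lp_norm_conjugate_le_1_iff:
  assumes "1 \<le> p"
  shows "lp_norm (conjugate_exponent p) n a \<le> 1 \<longleftrightarrow>
    (if p = 1 then (\<forall>i<n. \<bar>a i\<bar> \<le> 1) else (\<Sum>i<n. \<bar>a i\<bar> powr (p / (p - 1))) \<le> 1)"
proof (cases "p = 1")
  case True
  then show ?thesis by (auto simp: lp_norm_def conjugate_exponent_def)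
next
  case False
  define q where "q = p / (p - 1)"
  have q: "1 \<le> q" using False assms by (simp add: q_def field_simps)
  show ?thesis
    using powr_inverse_le_iff[OF q, of "\<Sum>i<n. \<bar>a i\<bar> powr q" 1] False
    by (simp add: lp_norm_def conjugate_exponent_def sum_nonneg flip: q_def)
qed

lemma lp_conjugate_abs_le_1:
  assumes "1 \<le> p" "lp_norm (conjugate_exponent p) n a \<le> 1" "i < n"
  shows "\<bar>a i\<bar> \<le> 1"
proof (cases "p = 1")
  case True
  then show ?thesis using assms by (simp add: lp_norm_conjugate_le_1_iff)
next
  case False
  define q where "q = p / (p - 1)"
  have q: "0 < q" using False assms by (simp add: q_def)
  have "\<bar>a i\<bar> powr q \<le> (\<Sum>i<n. \<bar>a i\<bar> powr q)"
    using assms(3) by (intro member_le_sum) auto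
  also have "\<dots> \<le> 1" using assms False by (simp add: lp_norm_conjugate_le_1_iff q_def)
  finally have "\<not> 1 < \<bar>a i\<bar> powr q" by simp
  then show ?thesis using q gr_one_powr[of "\<bar>a i\<bar>" q] by linarith
qed

lemma lp_conjugate_mono:
  assumes "1 \<le> p" "lp_norm (conjugate_exponent p) n a \<le> 1" "\<And>i. i < n \<Longrightarrow> \<bar>b i\<bar> \<le> \<bar>a i\<bar>"
  shows "lp_norm (conjugate_exponent p) n b \<le> 1"
proof (cases "p = 1")
  case True
  then show ?thesis using assms by (force simp: lp_norm_conjugate_le_1_iff)
next
  case False
  have "(\<Sum>i<n. \<bar>b i\<bar> powr (p / (p - 1))) \<le> (\<Sum>i<n. \<bar>a i\<bar> powr (p / (p - 1)))"
    using assms False by (intro sum_mono powr_mono2) auto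
  then show ?thesis using assms False by (simp add: lp_norm_conjugate_le_1_iff)
qed

lemma lp_Holder:
  assumes p: "1 \<le> p" and a: "lp_norm (conjugate_exponent p) n a \<le> 1"
  shows "\<bar>\<Sum>i<n. a i * t i\<bar> \<le> (\<Sum>i<n. \<bar>t i\<bar> powr p) powr (1 / p)"
proof -
  define T where "T = (\<Sum>i<n. \<bar>t i\<bar> powr p) powr (1 / p)"
  have Tp: "T powr p = (\<Sum>i<n. \<bar>t i\<bar> powr p)" using p by (simp add: T_def powr_powr sum_nonneg)
  have "\<bar>\<Sum>i<n. a i * t i\<bar> \<le> (\<Sum>i<n. \<bar>a i\<bar> * \<bar>t i\<bar>)"
    by (rule order_trans[OF sum_abs]) (simp add: abs_mult)
  also have "\<dots> \<le> T"
  proof (cases "p = 1")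
    case True
    then have "(\<Sum>i<n. \<bar>a i\<bar> * \<bar>t i\<bar>) \<le> (\<Sum>i<n. \<bar>t i\<bar>)"
      using a by (intro sum_mono mult_left_le_one_le) (auto simp: lp_norm_conjugate_le_1_iff)
    then show ?thesis using True by (simp add: T_def sum_nonneg)
  next
    case False
    define q where "q = p / (p - 1)"
    have p1: "1 < p" using p False by simp
    have q: "1 < q" "1 / q + 1 / p = 1" using p1 by (auto simp: q_def field_simps)
    have aq: "(\<Sum>i<n. \<bar>a i\<bar> powr q) \<le> 1" using a p False by (simp add: lp_norm_conjugate_le_1_iff q_def)
    show ?thesis
    proof (cases "T = 0")
      case True
      then have "(\<Sum>i<n. \<bar>t i\<bar> powr p) = 0" using Tp p by simp
      then have "\<forall>i<n. t i = 0" by (subst (asm) sum_nonneg_eq_0_iff) auto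
      then show ?thesis using True by simp
    next
      case F: False
      then have T: "0 < T" by (simp add: T_def)
      have "(\<Sum>i<n. \<bar>a i\<bar> * (\<bar>t i\<bar> / T)) \<le> (\<Sum>i<n. \<bar>a i\<bar> powr q / q + (\<bar>t i\<bar> / T) powr p / p)"
        using q p1 T by (intro sum_mono Youngs_inequality) auto
      also have "\<dots> = (\<Sum>i<n. \<bar>a i\<bar> powr q) / q + (\<Sum>i<n. \<bar>t i\<bar> powr p) / T powr p / p"
        using T by (simp add: sum.distrib powr_divide flip: sum_divide_distrib)
      also have "\<dots> \<le> 1 / q + 1 / p"
        using divide_right_mono[OF aq, of q] q T by (subst Tp[symmetric]) simp
      finally have "(\<Sum>i<n. \<bar>a i\<bar> * \<bar>t i\<bar>) / T \<le> 1"
        using q by (simp add: sum_divide_distrib)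
      then show ?thesis using T by (simp add: field_simps)
    qed
  qed
  finally show ?thesis by (simp add: T_def)
qed

lemma lp_Holder_attained:
  assumes p: "1 \<le> p"
  obtains a where "lp_norm (conjugate_exponent p) n a \<le> 1"
    and "(\<Sum>i<n. a i * t i) = (\<Sum>i<n. \<bar>t i\<bar> powr p) powr (1 / p)"
proof -
  define T where "T = (\<Sum>i<n. \<bar>t i\<bar> powr p) powr (1 / p)"
  have Tp: "T powr p = (\<Sum>i<n. \<bar>t i\<bar> powr p)" using p by (simp add: T_def powr_powr sum_nonneg)
  show thesis
  proof (cases "T = 0")
    case True
    show thesis
      by (rule that[of "\<lambda>_. 0"]) (use True p in \<open>auto simp: T_def lp_norm_conjugate_le_1_iff\<close>)
  next
    case False
    then have T: "0 < T" by (simp add: T_def)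
    \<comment> \<open>The case of equality in Hoelder's inequality: the conjugate power of
      \<open>\<bar>a i\<bar>\<close> is proportional to \<open>\<bar>t i\<bar> powr p\<close>. For
      \<open>p = 1\<close> this is just the sign of \<open>t i\<close>.\<close>
    define a where "a i = sgn (t i) * (\<bar>t i\<bar> / T) powr (p - 1)" for i
    have at: "a i * t i = \<bar>t i\<bar> powr p * T powr (1 - p)" for i
    proof (cases "t i = 0")
      case False
      have "a i * t i = (\<bar>t i\<bar> / T) powr (p - 1) * \<bar>t i\<bar>"
        by (simp add: a_def sgn_mult_abs abs_sgn mult_ac)
      then show ?thesis using False T by (simp add: powr_divide powr_diff field_simps)
    qed simp
    have "(\<Sum>i<n. a i * t i) = T powr p * T powr (1 - p)"
      by (simp add: at Tp flip: sum_distrib_right)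
    also have "\<dots> = T" using T by (simp flip: powr_add)
    finally have 1: "(\<Sum>i<n. a i * t i) = T" .
    have 2: "lp_norm (conjugate_exponent p) n a \<le> 1"
    proof (cases "p = 1")
      case True
      then show ?thesis by (auto simp: lp_norm_conjugate_le_1_iff a_def abs_mult abs_sgn_eq)
    next
      case False
      then have p1: "1 < p" using p by simp
      have "\<bar>a i\<bar> powr (p / (p - 1)) = \<bar>t i\<bar> powr p / T powr p" for i
      proof (cases "t i = 0")
        case False
        then show ?thesis using p1 T by (simp add: a_def abs_mult abs_sgn_eq powr_powr powr_divide)
      qed (use p1 in \<open>simp add: a_def\<close>)
      then have "(\<Sum>i<n. \<bar>a i\<bar> powr (p / (p - 1))) = T powr p / T powr p"
        by (simp add: Tp flip: sum_divide_distrib)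
      then show ?thesis using p1 T by (simp add: lp_norm_conjugate_le_1_iff)
    qed
    show thesis by (rule that[OF 2]) (simp add: 1 T_def)
  qed
qed

section \<open>Weak p-norms and homogeneous functions\<close>

text \<open>The supremum in \<open>weak_norm\<close> is taken in the reals, so it says something
  only once boundedness is known.\<close>

lemma weak_norm_bdd_above:
  assumes "1 \<le> p"
  shows "bdd_above {norm (\<Sum>i<n. a i *\<^sub>R z i) | a. lp_norm (conjugate_exponent p) n a \<le> 1}"
proof (rule bdd_aboveI)
  fix r assume "r \<in> {norm (\<Sum>i<n. a i *\<^sub>R z i) | a. lp_norm (conjugate_exponent p) n a \<le> 1}"
  then obtain a where a: "lp_norm (conjugate_exponent p) n a \<le> 1" "r = norm (\<Sum>i<n. a i *\<^sub>R z i)"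
    by blast
  have "r \<le> (\<Sum>i<n. \<bar>a i\<bar> * norm (z i))" unfolding a by (rule order_trans[OF norm_sum]) simp
  also have "\<dots> \<le> (\<Sum>i<n. norm (z i))"
    using lp_conjugate_abs_le_1[OF assms a(1)] by (intro sum_mono mult_left_le_one_le) auto
  finally show "r \<le> (\<Sum>i<n. norm (z i))" .
qed

lemma norm_combination_le_weak_norm:
  assumes "1 \<le> p" "lp_norm (conjugate_exponent p) n a \<le> 1"
  shows "norm (\<Sum>i<n. a i *\<^sub>R z i) \<le> weak_norm p n z"
  unfolding weak_norm_def using assms by (intro cSup_upper weak_norm_bdd_above) auto

lemma weak_norm_nonneg:
  assumes "1 \<le> p"
  shows "0 \<le> weak_norm p n z"
proof -
  have "lp_norm (conjugate_exponent p) n (\<lambda>_. 0) \<le> 1"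
    using assms by (simp add: lp_norm_conjugate_le_1_iff)
  from norm_combination_le_weak_norm[OF assms this, of z] show ?thesis by simp
qed

lemma lp_apply_le_weak_norm:
  fixes z :: "nat \<Rightarrow> 'a::real_normed_vector \<Rightarrow>\<^sub>L real"
  assumes p: "1 \<le> p"
  shows "(\<Sum>i<n. \<bar>z i x\<bar> powr p) powr (1 / p) \<le> weak_norm p n z * norm x"
proof -
  obtain a where a: "lp_norm (conjugate_exponent p) n a \<le> 1"
    and eq: "(\<Sum>i<n. a i * z i x) = (\<Sum>i<n. \<bar>z i x\<bar> powr p) powr (1 / p)"
    using lp_Holder_attained[OF p, where t = "\<lambda>i. z i x"] by blast
  have "(\<Sum>i<n. \<bar>z i x\<bar> powr p) powr (1 / p) = blinfun_apply (\<Sum>i<n. a i *\<^sub>R z i) x"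
    by (simp add: eq[symmetric] blinfun.sum_left blinfun.scaleR_left)
  also have "\<dots> \<le> norm (\<Sum>i<n. a i *\<^sub>R z i) * norm x"
    using norm_blinfun[of "\<Sum>i<n. a i *\<^sub>R z i" x] by simp
  also have "\<dots> \<le> weak_norm p n z * norm x"
    by (intro mult_right_mono norm_combination_le_weak_norm p a) auto
  finally show ?thesis .
qed

lemma sum_powr_apply_le_weak_norm:
  fixes z :: "nat \<Rightarrow> 'a::real_normed_vector \<Rightarrow>\<^sub>L real"
  assumes p: "1 \<le> p"
  shows "(\<Sum>i<n. \<bar>z i x\<bar> powr p) \<le> weak_norm p n z powr p * norm x powr p"
proof -
  have "(\<Sum>i<n. \<bar>z i x\<bar> powr p) \<le> (weak_norm p n z * norm x) powr p"
    using lp_apply_le_weak_norm[OF p, where n = n and z = z and x = x]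
    by (subst powr_inverse_le_iff[OF p, symmetric]) (auto simp: sum_nonneg weak_norm_nonneg p)
  then show ?thesis by (simp add: powr_mult weak_norm_nonneg p)
qed

text \<open>Together with \<open>sum_powr_apply_le_weak_norm\<close> this trades the supremum over
  coefficients for one over the unit ball of the underlying space. In that form a weak p-norm can be
  estimated by testing at points, which is what the separation argument delivers.\<close>

lemma weak_norm_le:
  fixes z :: "nat \<Rightarrow> 'a::real_normed_vector \<Rightarrow>\<^sub>L real"
  assumes p: "1 \<le> p" and C: "0 \<le> C"
    and le: "\<And>x. norm x \<le> 1 \<Longrightarrow> (\<Sum>i<n. \<bar>z i x\<bar> powr p) \<le> C powr p"
  shows "weak_norm p n z \<le> C"
  unfolding weak_norm_def
proof (rule cSup_least)
  have "lp_norm (conjugate_exponent p) n (\<lambda>_. 0) \<le> 1"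
    using p by (simp add: lp_norm_conjugate_le_1_iff)
  then show "{norm (\<Sum>i<n. a i *\<^sub>R z i) | a. lp_norm (conjugate_exponent p) n a \<le> 1} \<noteq> {}" by blast
next
  fix r assume "r \<in> {norm (\<Sum>i<n. a i *\<^sub>R z i) | a. lp_norm (conjugate_exponent p) n a \<le> 1}"
  then obtain a where a: "lp_norm (conjugate_exponent p) n a \<le> 1" "r = norm (\<Sum>i<n. a i *\<^sub>R z i)"
    by blast
  have 1: "\<bar>\<Sum>i<n. a i * z i x\<bar> \<le> C" if "norm x \<le> 1" for x
  proof -
    have "\<bar>\<Sum>i<n. a i * z i x\<bar> \<le> (\<Sum>i<n. \<bar>z i x\<bar> powr p) powr (1 / p)"
      by (rule lp_Holder[OF p a(1)])
    also have "\<dots> \<le> C" using le[OF that] p C by (subst powr_inverse_le_iff) (auto simp: sum_nonneg)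
    finally show ?thesis .
  qed
  have "norm (\<Sum>i<n. a i *\<^sub>R z i) \<le> C"
  proof (rule norm_blinfun_bound[OF C])
    fix x :: 'a
    show "norm (blinfun_apply (\<Sum>i<n. a i *\<^sub>R z i) x) \<le> C * norm x"
    proof (cases "x = 0")
      case False
      have "\<bar>\<Sum>i<n. a i * z i (x /\<^sub>R norm x)\<bar> \<le> C" using False by (intro 1) simp
      moreover have "(\<Sum>i<n. a i * z i (x /\<^sub>R norm x)) = (\<Sum>i<n. a i * z i x) / norm x"
        by (simp add: blinfun.scaleR_right sum_distrib_left divide_inverse mult_ac)
      ultimately have "\<bar>(\<Sum>i<n. a i * z i x) / norm x\<bar> \<le> C" by metis
      then show ?thesis
        using False by (simp add: blinfun.sum_left blinfun.scaleR_left pos_divide_le_eq)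
    qed simp
  qed
  then show "r \<le> C" by (simp add: a)
qed

text \<open>The condition inside \<open>p_norm\<close> for one real constant; working with it keeps
  all estimates out of \<open>ennreal\<close>.\<close>

definition p_bounded_by :: "real \<Rightarrow> real \<Rightarrow> (('a::banach \<Rightarrow>\<^sub>L real) \<Rightarrow> real) \<Rightarrow> bool" where
  "p_bounded_by p C f \<longleftrightarrow> (\<forall>n \<phi>.
    (\<Sum>i<n. \<bar>f (\<phi> i)\<bar> powr p) powr (1 / p) \<le> C * weak_norm p n \<phi>)"

text \<open>The infimum is attained: each inequality is closed in the constant, so it persists when
  the constant decreases to \<open>C\<close>.\<close>

lemma p_norm_le_iff:
  assumes p: "1 \<le> p" and C: "0 \<le> C"
  shows "p_norm p f \<le> ennreal C \<longleftrightarrow> p_bounded_by p C f"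
proof
  assume "p_bounded_by p C f"
  then show "p_norm p f \<le> ennreal C"
    unfolding p_norm_def p_bounded_by_def using C by (intro Inf_lower) auto
next
  assume le: "p_norm p f \<le> ennreal C"
  show "p_bounded_by p C f"
    unfolding p_bounded_by_def
  proof (intro allI)
    fix n and \<phi> :: "nat \<Rightarrow> 'a \<Rightarrow>\<^sub>L real"
    let ?W = "weak_norm p n \<phi>"
    have W: "0 \<le> ?W" by (rule weak_norm_nonneg[OF p])
    show "(\<Sum>i<n. \<bar>f (\<phi> i)\<bar> powr p) powr (1 / p) \<le> C * ?W"
    proof (rule field_le_epsilon)
      fix e :: real assume e: "0 < e"
      \<comment> \<open>The \<open>+ 1\<close> covers a vanishing weak norm.\<close>
      define e' where "e' = e / (?W + 1)"
      have e': "0 < e'" "e' * ?W \<le> e" using e W by (auto simp: e'_def field_simps)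
      have "p_norm p f < ennreal (C + e')"
        using le e' C by (intro le_less_trans[OF le]) (simp add: ennreal_less_iff)
      then obtain D where D: "0 \<le> D" "ennreal D < ennreal (C + e')"
        "(\<Sum>i<n. \<bar>f (\<phi> i)\<bar> powr p) powr (1 / p) \<le> D * ?W"
        unfolding p_norm_def Inf_less_iff by blast
      have "D * ?W \<le> (C + e') * ?W" using D W by (intro mult_right_mono) (auto simp: ennreal_less_iff)
      also have "\<dots> \<le> C * ?W + e" using e' by (simp add: algebra_simps)
      finally show "(\<Sum>i<n. \<bar>f (\<phi> i)\<bar> powr p) powr (1 / p) \<le> C * ?W + e" using D by linarith
    qed
  qed
qed

lemma p_norm_finite_iff:
  assumes p: "1 \<le> p"
  shows "p_norm p f < \<infinity> \<longleftrightarrow> (\<exists>C\<ge>0. p_bounded_by p C f)"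
proof
  assume "p_norm p f < \<infinity>"
  then have "p_norm p f \<le> ennreal (enn2real (p_norm p f))" by (simp add: ennreal_enn2real)
  then show "\<exists>C\<ge>0. p_bounded_by p C f" using p_norm_le_iff[OF p] enn2real_nonneg by blast
next
  assume "\<exists>C\<ge>0. p_bounded_by p C f"
  then obtain C where "p_norm p f \<le> ennreal C" using p_norm_le_iff[OF p] by blast
  then show "p_norm p f < \<infinity>" by (simp add: order_le_less_trans)
qed

lemma p_bounded_by_add:
  assumes p: "1 \<le> p" and f: "p_bounded_by p C f" and g: "p_bounded_by p D g"
  shows "p_bounded_by p (C + D) (\<lambda>\<phi>. f \<phi> + g \<phi>)"
  unfolding p_bounded_by_def
proof (intro allI)
  fix n and \<phi> :: "nat \<Rightarrow> 'a \<Rightarrow>\<^sub>L real"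
  have "(\<Sum>i<n. \<bar>f (\<phi> i) + g (\<phi> i)\<bar> powr p) powr (1 / p) \<le>
      (\<Sum>i<n. \<bar>f (\<phi> i)\<bar> powr p) powr (1 / p) + (\<Sum>i<n. \<bar>g (\<phi> i)\<bar> powr p) powr (1 / p)"
    by (rule sum_powr_triangle[OF p])
  also have "\<dots> \<le> C * weak_norm p n \<phi> + D * weak_norm p n \<phi>"
    using f g unfolding p_bounded_by_def by (intro add_mono) auto
  finally show "(\<Sum>i<n. \<bar>f (\<phi> i) + g (\<phi> i)\<bar> powr p) powr (1 / p) \<le> (C + D) * weak_norm p n \<phi>"
    by (simp add: algebra_simps)
qed

lemma p_bounded_by_scale:
  assumes p: "1 \<le> p" and f: "p_bounded_by p C f"
  shows "p_bounded_by p (\<bar>c\<bar> * C) (\<lambda>\<phi>. c * f \<phi>)"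
  unfolding p_bounded_by_def
proof (intro allI)
  fix n and \<phi> :: "nat \<Rightarrow> 'a \<Rightarrow>\<^sub>L real"
  have "(\<Sum>i<n. \<bar>c * f (\<phi> i)\<bar> powr p) powr (1 / p) = \<bar>c\<bar> * (\<Sum>i<n. \<bar>f (\<phi> i)\<bar> powr p) powr (1 / p)"
    using p by (simp add: abs_mult powr_mult sum_nonneg powr_powr flip: sum_distrib_left)
  also have "\<dots> \<le> \<bar>c\<bar> * (C * weak_norm p n \<phi>)"
    using f unfolding p_bounded_by_def by (intro mult_left_mono) auto
  finally show "(\<Sum>i<n. \<bar>c * f (\<phi> i)\<bar> powr p) powr (1 / p) \<le> \<bar>c\<bar> * C * weak_norm p n \<phi>"
    by (simp add: algebra_simps)
qed

lemma p_bounded_by_mono: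
  assumes p: "1 \<le> p" and f: "p_bounded_by p C f" and le: "\<And>\<phi>. \<bar>g \<phi>\<bar> \<le> \<bar>f \<phi>\<bar>" and CD: "C \<le> D"
  shows "p_bounded_by p D g"
  unfolding p_bounded_by_def
proof (intro allI)
  fix n and \<phi> :: "nat \<Rightarrow> 'a \<Rightarrow>\<^sub>L real"
  have "(\<Sum>i<n. \<bar>g (\<phi> i)\<bar> powr p) powr (1 / p) \<le> (\<Sum>i<n. \<bar>f (\<phi> i)\<bar> powr p) powr (1 / p)"
    using p le by (intro powr_mono2 sum_mono) (auto simp: sum_nonneg)
  also have "\<dots> \<le> C * weak_norm p n \<phi>" using f unfolding p_bounded_by_def by auto
  also have "\<dots> \<le> D * weak_norm p n \<phi>" using CD by (intro mult_right_mono weak_norm_nonneg p)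
  finally show "(\<Sum>i<n. \<bar>g (\<phi> i)\<bar> powr p) powr (1 / p) \<le> D * weak_norm p n \<phi>" .
qed

lemma p_bounded_by_evaluation:
  assumes "1 \<le> p"
  shows "p_bounded_by p (norm x) (evaluation x)"
  using lp_apply_le_weak_norm[OF assms, where x = x]
  by (simp add: p_bounded_by_def evaluation_def mult.commute)

text \<open>The case of a single functional. It shows that the p-norm controls the supremum on every
  norm-bounded set.\<close>

lemma p_bounded_by_abs_le:
  assumes p: "1 \<le> p" and f: "p_bounded_by p C f" and C: "0 \<le> C"
  shows "\<bar>f \<phi>\<bar> \<le> C * norm \<phi>"
proof -
  have "\<bar>f \<phi>\<bar> = (\<Sum>i<1::nat. \<bar>f \<phi>\<bar> powr p) powr (1 / p)" using p by (simp add: powr_powr)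
  also have "\<dots> \<le> C * weak_norm p 1 (\<lambda>_. \<phi>)" using f[unfolded p_bounded_by_def, rule_format, of "\<lambda>_. \<phi>" 1] by simp
  also have "weak_norm p 1 (\<lambda>_. \<phi>) \<le> norm \<phi>"
  proof (rule weak_norm_le[OF p])
    fix x :: 'a assume "norm x \<le> 1"
    then have "\<bar>\<phi> x\<bar> \<le> norm \<phi>" using norm_blinfun[of \<phi> x] mult_left_le[of "norm x" "norm \<phi>"] by simp
    then show "(\<Sum>i<1::nat. \<bar>\<phi> x\<bar> powr p) \<le> norm \<phi> powr p" using p by (simp add: powr_mono2)
  qed simp
  finally show ?thesis using C by (simp add: mult_left_mono)
qed

section \<open>Homogeneous functions, the free vector lattice and its closure\<close>

lemma Hw_scaleR: "f \<in> Hw \<Longrightarrow> 0 \<le> c \<Longrightarrow> f (c *\<^sub>R \<phi>) = c * f \<phi>"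
  by (simp add: Hw_def)

lemma Hw_continuous_map:
  "f \<in> Hw \<Longrightarrow> bounded B \<Longrightarrow> continuous_map (subtopology weak_star_topology B) euclideanreal f"
  by (simp add: Hw_def)

lemma vector_sublattice_Hw: "vector_sublattice Hw Hw"
  unfolding vector_sublattice_def function_subspace_def Hw_def
  by (auto intro!: continuous_intros simp: algebra_simps max_mult_distrib_left min_mult_distrib_left
      dest: spec)

lemma abs_in_Hw: "f \<in> Hw \<Longrightarrow> (\<lambda>\<phi>. \<bar>f \<phi>\<bar>) \<in> Hw"
  by (auto simp: Hw_def abs_mult intro!: continuous_intros)

lemma evaluation_in_Hw: "evaluation x \<in> Hw"
  unfolding Hw_def evaluation_def
  by (auto simp: blinfun.scaleR_left
      intro!: continuous_map_from_subtopology strong_operator_topology_continuous_evaluation)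

lemma FVL_subset_Hw: "FVL \<subseteq> Hw"
  unfolding FVL_def using vector_sublattice_Hw evaluation_in_Hw by blast

lemma evaluation_in_FVL: "evaluation x \<in> FVL"
  unfolding FVL_def by auto

lemma FVL_zero: "(\<lambda>_. 0) \<in> FVL"
  and FVL_add: "f \<in> FVL \<Longrightarrow> g \<in> FVL \<Longrightarrow> (\<lambda>\<phi>. f \<phi> + g \<phi>) \<in> FVL"
  and FVL_scale: "f \<in> FVL \<Longrightarrow> (\<lambda>\<phi>. c * f \<phi>) \<in> FVL"
  and FVL_max: "f \<in> FVL \<Longrightarrow> g \<in> FVL \<Longrightarrow> (\<lambda>\<phi>. max (f \<phi>) (g \<phi>)) \<in> FVL"
  by (auto simp: FVL_def vector_sublattice_def function_subspace_def)

lemma FVL_sum: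
  assumes "finite I" "\<And>i. i \<in> I \<Longrightarrow> f i \<in> FVL"
  shows "(\<lambda>\<phi>. \<Sum>i\<in>I. f i \<phi>) \<in> FVL"
  using assms by (induction I) (auto intro: FVL_zero FVL_add)

lemma FVL_Max:
  assumes "finite I" "I \<noteq> {}" "\<And>i. i \<in> I \<Longrightarrow> f i \<in> FVL"
  shows "(\<lambda>\<phi>. Max ((\<lambda>i. f i \<phi>) ` I)) \<in> FVL"
  using assms by (induction I rule: finite_ne_induct) (auto intro: FVL_max)

text \<open>Convergence in p-norm is uniform on norm-bounded sets, so weak-star continuity there
  survives the limit.\<close>

lemma Hw_limit:
  assumes p: "1 \<le> p"
    and hom: "\<And>c \<phi>. 0 \<le> c \<Longrightarrow> f (c *\<^sub>R \<phi>) = c * f \<phi>"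
    and lim: "\<And>e. 0 < e \<Longrightarrow> \<exists>h\<in>Hw. p_bounded_by p e (\<lambda>\<phi>. f \<phi> - h \<phi>)"
  shows "f \<in> Hw"
  unfolding Hw_def
proof (intro CollectI conjI allI impI hom)
  fix B :: "('a \<Rightarrow>\<^sub>L real) set" assume "bounded B"
  then obtain R where R: "0 < R" "\<And>\<phi>. \<phi> \<in> B \<Longrightarrow> norm \<phi> \<le> R" by (auto simp: bounded_pos)
  let ?T = "subtopology weak_star_topology B"
  have "\<exists>h\<in>Hw. p_bounded_by p (inverse (real (Suc n))) (\<lambda>\<phi>. f \<phi> - h \<phi>)" for n
    by (rule lim) simp
  then obtain h where h: "\<And>n. h n \<in> Hw" "\<And>n. p_bounded_by p (inverse (real (Suc n))) (\<lambda>\<phi>. f \<phi> - h n \<phi>)"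
    by metis
  have "continuous_map ?T Met_TC.mtopology f"
  proof (rule Met_TC.continuous_map_uniform_limit[where F = sequentially and f = h])
    show "\<forall>\<^sub>F n in sequentially. continuous_map ?T Met_TC.mtopology (h n)"
      using Hw_continuous_map[OF h(1) \<open>bounded B\<close>] by simp
  next
    fix e :: real assume e: "0 < e"
    have "(\<lambda>n. inverse (real (Suc n)) * R) \<longlonglongrightarrow> 0 * R"
      by (intro tendsto_intros LIMSEQ_inverse_real_of_nat)
    then have "\<forall>\<^sub>F n in sequentially. inverse (real (Suc n)) * R < e"
      using e by (intro order_tendstoD(2)) auto
    then show "\<forall>\<^sub>F n in sequentially. \<forall>\<phi>\<in>topspace ?T. f \<phi> \<in> UNIV \<and> dist (h n \<phi>) (f \<phi>) < e"
    proof eventually_elim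
      case (elim n)
      have "dist (h n \<phi>) (f \<phi>) < e" if "\<phi> \<in> B" for \<phi>
      proof -
        have "dist (h n \<phi>) (f \<phi>) \<le> inverse (real (Suc n)) * norm \<phi>"
          using p_bounded_by_abs_le[OF p h(2)[of n], where \<phi> = \<phi>] by (simp add: dist_real_def abs_minus_commute)
        also have "\<dots> \<le> inverse (real (Suc n)) * R" using R(2)[OF that] by (intro mult_left_mono) auto
        finally show ?thesis using elim by linarith
      qed
      then show ?case by auto
    qed
  qed simp
  then show "continuous_map ?T euclideanreal f" by simp
qed

text \<open>Continuity of \<open>f\<close> is a conclusion here: it is inherited from the
  approximants in \<open>FVL\<close>, so a majorant given by an integral need not be shown
  continuous by hand.\<close>

lemma FBL_I:
  assumes p: "1 \<le> p" and C: "0 \<le> C"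
    and hom: "\<And>c \<phi>. 0 \<le> c \<Longrightarrow> f (c *\<^sub>R \<phi>) = c * f \<phi>"
    and bound: "p_bounded_by p C f"
    and lim: "\<And>e. 0 < e \<Longrightarrow> \<exists>h\<in>FVL. p_bounded_by p e (\<lambda>\<phi>. f \<phi> - h \<phi>)"
  shows "f \<in> FBL p"
  unfolding FBL_def Hwp_def
proof (intro CollectI conjI allI impI)
  show "f \<in> Hw" using lim FVL_subset_Hw by (intro Hw_limit[OF p hom]) blast+
  show "p_norm p f < \<infinity>" using bound C p_norm_finite_iff[OF p] by blast
next
  fix e :: ennreal assume "0 < e"
  \<comment> \<open>A value strictly below \<open>e\<close> is finite, hence a real number, and
    leaves room to turn the bound \<open>\<le> d\<close> into \<open>< e\<close>.\<close>
  then obtain d where d: "0 < d" "d < e" using dense by blast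
  then have dd: "d = ennreal (enn2real d)"
    using order_less_le_trans[OF d(2) top_greatest] by simp
  then have "0 < enn2real d" using d by (metis ennreal_0 enn2real_nonneg order_less_le)
  from lim[OF this] obtain h where "h \<in> FVL" "p_bounded_by p (enn2real d) (\<lambda>\<phi>. f \<phi> - h \<phi>)" by blast
  then have "p_norm p (\<lambda>\<phi>. f \<phi> - h \<phi>) \<le> d"
    using p_norm_le_iff[OF p enn2real_nonneg] dd by metis
  with \<open>h \<in> FVL\<close> d show "\<exists>h\<in>FVL. p_norm p (\<lambda>\<phi>. f \<phi> - h \<phi>) < e" by (meson order_le_less_trans)
qed

text \<open>Solidity is the monotonicity of p-sums in absolute values. This gives the easy inclusion
  of \<open>Iwp p\<close> in \<open>Hwp p\<close>, which is then one of the ideals being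
  intersected.\<close>

lemma order_ideal_Hwp:
  assumes p: "1 \<le> p"
  shows "order_ideal Hw (Hwp p)"
proof -
  have sub: "function_subspace (Hw :: (('a \<Rightarrow>\<^sub>L real) \<Rightarrow> real) set)"
    using vector_sublattice_Hw unfolding vector_sublattice_def by blast
  have iff: "f \<in> Hwp p \<longleftrightarrow> f \<in> Hw \<and> (\<exists>C\<ge>0. p_bounded_by p C f)"
    for f :: "('a \<Rightarrow>\<^sub>L real) \<Rightarrow> real"
    unfolding Hwp_def mem_Collect_eq p_norm_finite_iff[OF p] ..
  have 0: "(\<lambda>_. 0) \<in> (Hwp p :: (('a \<Rightarrow>\<^sub>L real) \<Rightarrow> real) set)"
  proof -
    have "(\<lambda>_. 0) \<in> (Hw :: (('a \<Rightarrow>\<^sub>L real) \<Rightarrow> real) set)"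
      using sub by (simp only: function_subspace_def)
    moreover have "p_bounded_by p 0 (\<lambda>_ :: 'a \<Rightarrow>\<^sub>L real. 0)" by (simp add: p_bounded_by_def)
    ultimately show ?thesis unfolding iff by blast
  qed
  have 1: "(\<lambda>t. f t + g t) \<in> Hwp p" if fg: "f \<in> Hwp p" "g \<in> Hwp p" for f g :: "('a \<Rightarrow>\<^sub>L real) \<Rightarrow> real"
  proof -
    obtain C D where CD: "f \<in> Hw" "0 \<le> C" "p_bounded_by p C f" "g \<in> Hw" "0 \<le> D" "p_bounded_by p D g"
      using fg unfolding iff by blast
    then have "(\<lambda>t. f t + g t) \<in> Hw" using sub by (simp only: function_subspace_def)
    with p_bounded_by_add[OF p CD(3,6)] CD show ?thesis unfolding iff by (blast intro: add_nonneg_nonneg)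
  qed
  have 2: "(\<lambda>t. c * f t) \<in> Hwp p" if fg: "f \<in> Hwp p" for f :: "('a \<Rightarrow>\<^sub>L real) \<Rightarrow> real" and c
  proof -
    obtain C where C: "f \<in> Hw" "0 \<le> C" "p_bounded_by p C f" using fg unfolding iff by blast
    then have "(\<lambda>t. c * f t) \<in> Hw" using sub by (simp only: function_subspace_def)
    moreover have "0 \<le> \<bar>c\<bar> * C" using C by simp
    ultimately show ?thesis using p_bounded_by_scale[OF p C(3)] unfolding iff by blast
  qed
  have 3: "f \<in> Hwp p" if fg: "f \<in> Hw" "g \<in> Hwp p" "\<forall>t. \<bar>f t\<bar> \<le> \<bar>g t\<bar>" for f g :: "('a \<Rightarrow>\<^sub>L real) \<Rightarrow> real"
  proof -
    obtain C where C: "0 \<le> C" "p_bounded_by p C g" using fg unfolding iff by blast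
    have "p_bounded_by p C f" using fg(3) by (intro p_bounded_by_mono[OF p C(2)]) auto
    with fg(1) C(1) show ?thesis unfolding iff by blast
  qed
  show ?thesis
    unfolding order_ideal_def function_subspace_def using 0 1 2 3 by (auto simp: Hwp_def)
qed

section \<open>Approximation of finite p-sums of evaluations\<close>

lemma p_bounded_by_sum_abs_evaluation:
  fixes x :: "nat \<Rightarrow> 'a::banach"
  assumes p: "1 \<le> p"
  shows "p_bounded_by p (\<Sum>j<m. norm (x j)) (\<lambda>\<phi>. \<Sum>j<m. \<bar>\<phi> (x j)\<bar>)"
proof (induction m)
  case 0
  show ?case using p by (simp add: p_bounded_by_def)
next
  case (Suc m)
  have "p_bounded_by p (norm (x m)) (\<lambda>\<phi>. \<bar>\<phi> (x m)\<bar>)"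
    by (rule p_bounded_by_mono[OF p p_bounded_by_evaluation[OF p]]) (auto simp: evaluation_def)
  from p_bounded_by_add[OF p Suc this] show ?case by simp
qed

lemma truncate_to_grid:
  fixes a :: real and N :: nat
  assumes "\<bar>a\<bar> \<le> 1" "0 < N"
  obtains k :: int where "k \<in> {- int N..int N}" "\<bar>real_of_int k / N\<bar> \<le> \<bar>a\<bar>" "\<bar>real_of_int k / N - a\<bar> \<le> 1 / N"
proof -
  define k where "k = (if 0 \<le> a then \<lfloor>N * a\<rfloor> else \<lceil>N * a\<rceil>)"
  have 1: "\<bar>real_of_int k\<bar> \<le> N * \<bar>a\<bar>"
  proof (cases "0 \<le> a")
    case True
    then have "0 \<le> \<lfloor>N * a\<rfloor>" by simp
    then show ?thesis using True of_int_floor_le[of "N * a"] by (simp add: k_def)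
  next
    case False
    then have "\<lceil>N * a\<rceil> \<le> 0" by (simp add: mult_nonneg_nonpos)
    then show ?thesis using False le_of_int_ceiling[of "N * a"] by (simp add: k_def)
  qed
  have 2: "\<bar>real_of_int k - N * a\<bar> \<le> 1"
    unfolding k_def by (simp, linarith)
  show thesis
  proof
    have "N * \<bar>a\<bar> \<le> N" using assms by (simp add: mult_left_le)
    with 1 show "k \<in> {- int N..int N}" by auto
    show "\<bar>real_of_int k / N\<bar> \<le> \<bar>a\<bar>" using 1 assms by (simp add: field_simps)
    have "real_of_int k / N - a = (real_of_int k - N * a) / N"
      using assms by (simp add: field_simps)
    with 2 show "\<bar>real_of_int k / N - a\<bar> \<le> 1 / N" by (simp add: divide_right_mono)
  qed
qed

text \<open>The dual unit vectors are replaced by finitely many, rounded towards zero to a grid; rounding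
  in this direction keeps them in the dual unit ball.\<close>

lemma FVL_approximates_lp_sum:
  fixes x :: "nat \<Rightarrow> 'a::banach"
  assumes p: "1 \<le> p" and e: "0 < e"
  shows "\<exists>h\<in>FVL. p_bounded_by p e (\<lambda>\<phi>. (\<Sum>j<m. \<bar>blinfun_apply \<phi> (x j)\<bar> powr p) powr (1 / p) - h \<phi>)"
proof -
  let ?G = "\<lambda>\<phi> :: 'a \<Rightarrow>\<^sub>L real. (\<Sum>j<m. \<bar>\<phi> (x j)\<bar> powr p) powr (1 / p)"
  let ?S = "\<Sum>j<m. norm (x j)"
  obtain N :: nat where N: "0 < N" "?S / e \<le> N"
    by (metis reals_Archimedean2 less_eq_real_def max_less_iff_conj of_nat_0_less_iff)
  define A where "A = {a \<in> PiE {..<m} (\<lambda>_. (\<lambda>k. real_of_int k / N) ` {- int N..int N}).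
    lp_norm (conjugate_exponent p) m a \<le> 1}"
  \<comment> \<open>By duality the p-sum is the maximum of such linear expressions over all
    coefficient vectors in the dual ball. Over the finite set \<open>A\<close> the maximum is a
    lattice operation on combinations of evaluations.\<close>
  define h where "h \<phi> = Max ((\<lambda>a. \<Sum>j<m. a j * \<phi> (x j)) ` A)" for \<phi> :: "'a \<Rightarrow>\<^sub>L real"
  have fin: "finite A" unfolding A_def by (rule finite_Collect_conjI) (auto intro!: finite_PiE)
  have round: "\<exists>a\<in>A. ?G \<phi> - (\<Sum>j<m. a j * \<phi> (x j)) \<le> (1 / real N) * (\<Sum>j<m. \<bar>\<phi> (x j)\<bar>)" for \<phi> :: "'a \<Rightarrow>\<^sub>L real"
  proof -
    obtain b where b: "lp_norm (conjugate_exponent p) m b \<le> 1" "(\<Sum>j<m. b j * \<phi> (x j)) = ?G \<phi>"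
      using lp_Holder_attained[OF p, where t = "\<lambda>j. \<phi> (x j)"] by blast
    have "\<forall>j\<in>{..<m}. \<exists>k\<in>{- int N..int N}. \<bar>real_of_int k / N\<bar> \<le> \<bar>b j\<bar> \<and> \<bar>real_of_int k / N - b j\<bar> \<le> 1 / N"
      using truncate_to_grid[OF lp_conjugate_abs_le_1[OF p b(1)] N(1)] by (metis lessThan_iff)
    then obtain k where k: "\<And>j. j < m \<Longrightarrow> k j \<in> {- int N..int N}"
      "\<And>j. j < m \<Longrightarrow> \<bar>real_of_int (k j) / N\<bar> \<le> \<bar>b j\<bar>"
      "\<And>j. j < m \<Longrightarrow> \<bar>real_of_int (k j) / N - b j\<bar> \<le> 1 / N"
      by (metis lessThan_iff)
    define a where "a = restrict (\<lambda>j. real_of_int (k j) / N) {..<m}"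
    have "lp_norm (conjugate_exponent p) m a \<le> 1"
      by (rule lp_conjugate_mono[OF p b(1)]) (use k in \<open>auto simp: a_def\<close>)
    then have "a \<in> A" using k by (auto simp: A_def a_def)
    moreover have "?G \<phi> - (\<Sum>j<m. a j * \<phi> (x j)) \<le> (1 / real N) * (\<Sum>j<m. \<bar>\<phi> (x j)\<bar>)"
    proof -
      have "?G \<phi> - (\<Sum>j<m. a j * \<phi> (x j)) = (\<Sum>j<m. (b j - a j) * \<phi> (x j))"
        by (simp add: b(2)[symmetric] sum_subtractf algebra_simps)
      also have "\<dots> \<le> (\<Sum>j<m. \<bar>b j - a j\<bar> * \<bar>\<phi> (x j)\<bar>)"
        by (intro sum_mono) (metis abs_ge_self abs_mult)
      also have "\<dots> \<le> (\<Sum>j<m. (1 / real N) * \<bar>\<phi> (x j)\<bar>)"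
        using k(3) by (intro sum_mono mult_right_mono) (auto simp: a_def abs_minus_commute)
      finally show ?thesis by (simp add: sum_distrib_left)
    qed
    ultimately show ?thesis by blast
  qed
  then have ne: "A \<noteq> {}" by blast
  have hin: "h \<in> FVL"
    unfolding h_def using fin ne FVL_scale[OF evaluation_in_FVL]
    by (intro FVL_Max FVL_sum) (auto simp: evaluation_def)
  have up: "h \<phi> \<le> ?G \<phi>" for \<phi>
  proof -
    have "(\<Sum>j<m. a j * \<phi> (x j)) \<le> ?G \<phi>" if "a \<in> A" for a
      using lp_Holder[OF p, of m a "\<lambda>j. \<phi> (x j)"] that by (auto simp: A_def)
    then show ?thesis unfolding h_def using fin ne by simp
  qed
  have low: "?G \<phi> - h \<phi> \<le> (1 / real N) * (\<Sum>j<m. \<bar>\<phi> (x j)\<bar>)" for \<phi> :: "'a \<Rightarrow>\<^sub>L real"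
  proof -
    obtain a where a: "a \<in> A" "?G \<phi> - (\<Sum>j<m. a j * \<phi> (x j)) \<le> (1 / real N) * (\<Sum>j<m. \<bar>\<phi> (x j)\<bar>)"
      using round by blast
    have "(\<Sum>j<m. a j * \<phi> (x j)) \<le> h \<phi>" unfolding h_def using fin a by (intro Max_ge) auto
    with a show ?thesis by linarith
  qed
  have "p_bounded_by p (\<bar>1 / real N\<bar> * ?S) (\<lambda>\<phi> :: 'a \<Rightarrow>\<^sub>L real. (1 / real N) * (\<Sum>j<m. \<bar>\<phi> (x j)\<bar>))"
    by (rule p_bounded_by_scale[OF p p_bounded_by_sum_abs_evaluation[OF p]])
  then have "p_bounded_by p e (\<lambda>\<phi>. ?G \<phi> - h \<phi>)"
  proof (rule p_bounded_by_mono[OF p])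
    show "\<bar>?G \<phi> - h \<phi>\<bar> \<le> \<bar>(1 / real N) * (\<Sum>j<m. \<bar>\<phi> (x j)\<bar>)\<bar>" for \<phi>
      using up[of \<phi>] low[of \<phi>] by linarith
    show "\<bar>1 / real N\<bar> * ?S \<le> e" using N e by (simp add: field_simps)
  qed
  with hin show ?thesis by blast
qed

section \<open>Finitely additive measures and the Stone space\<close>

definition charge :: "('a set \<Rightarrow> real) \<Rightarrow> bool" where
  "charge m \<longleftrightarrow> (\<forall>A. 0 \<le> m A) \<and> (\<forall>A B. A \<inter> B = {} \<longrightarrow> m (A \<union> B) = m A + m B) \<and> m UNIV = 1"

text \<open>Ultrafilters are encoded as two-valued charges, which makes the Stone space a closed
  part of the space of charges and hands it its compact topology.\<close>

definition ultrafilter_charge :: "('a set \<Rightarrow> real) \<Rightarrow> bool" where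
  "ultrafilter_charge u \<longleftrightarrow> charge u \<and> (\<forall>A. u A = 0 \<or> u A = 1)"

lemma charge_nonneg: "charge m \<Longrightarrow> 0 \<le> m A"
  and charge_union: "charge m \<Longrightarrow> A \<inter> B = {} \<Longrightarrow> m (A \<union> B) = m A + m B"
  and charge_UNIV: "charge m \<Longrightarrow> m UNIV = 1"
  by (auto simp: charge_def)

lemma charge_empty: "charge m \<Longrightarrow> m {} = 0"
  using charge_union[of m "{}" "{}"] by simp

lemma charge_mono:
  assumes "charge m" "A \<subseteq> B"
  shows "m A \<le> m B"
proof -
  have "m B = m A + m (B - A)"
    using charge_union[OF assms(1), of A "B - A"] assms(2) by (simp add: Un_absorb1)
  then show ?thesis using charge_nonneg[OF assms(1), of "B - A"] by simp
qed

lemma charge_Compl: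
  assumes "charge m"
  shows "m (- A) = 1 - m A"
  using charge_union[OF assms, of A "- A"] charge_UNIV[OF assms] by simp

lemma charge_le_1: "charge m \<Longrightarrow> m A \<le> 1"
  using charge_mono[of m A UNIV] charge_UNIV[of m] by simp

lemma charge_dirac: "charge (\<lambda>A. indicator A x)"
  by (auto simp: charge_def indicator_def)

lemma charge_convex:
  assumes "charge m" "charge m'" "0 \<le> \<tau>" "\<tau> \<le> 1"
  shows "charge (\<lambda>A. (1 - \<tau>) * m A + \<tau> * m' A)"
  unfolding charge_def
proof (intro conjI allI impI)
  show "0 \<le> (1 - \<tau>) * m A + \<tau> * m' A" for A
    using assms charge_nonneg[of m A] charge_nonneg[of m' A] by simp
qed (use assms in \<open>auto simp: charge_union charge_UNIV algebra_simps\<close>)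

text \<open>Charges form a closed subset of a cube, compact by Tychonoff. Closedness rests on finite
  additivity: each condition involves finitely many coordinates.\<close>

lemma compact_charges: "compact {m :: 'a set \<Rightarrow> real. charge m}"
proof -
  let ?K = "PiE UNIV (\<lambda>_ :: 'a set. {0..1 :: real})"
  let ?C = "{m :: 'a set \<Rightarrow> real. (\<forall>A. 0 \<le> m A) \<and> (\<forall>A B. A \<inter> B = {} \<longrightarrow> m (A \<union> B) = m A + m B) \<and> m UNIV = 1}"
  have "compactin (product_topology (\<lambda>_. euclidean) UNIV) ?K"
    by (simp add: compactin_PiE)
  then have "compact ?K" by (simp add: euclidean_product_topology)
  moreover have "closed ?C"
    by (intro closed_Collect_conj closed_Collect_all closed_Collect_imp closed_Collect_le
        closed_Collect_eq continuous_intros continuous_on_product_coordinates) auto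
  ultimately have "compact (?K \<inter> ?C)" by (rule compact_Int_closed)
  also have "?K \<inter> ?C = {m. charge m}"
  proof -
    have "m \<in> ?K" if "charge m" for m :: "'a set \<Rightarrow> real"
      using charge_nonneg[OF that] charge_le_1[OF that] by (auto simp: PiE_def)
    then show ?thesis unfolding charge_def by blast
  qed
  finally show ?thesis .
qed

lemma compact_ultrafilter_charges: "compact {u :: 'a set \<Rightarrow> real. ultrafilter_charge u}"
proof -
  have "closed {u :: 'a set \<Rightarrow> real. \<forall>A. u A = 0 \<or> u A = 1}"
    by (intro closed_Collect_all closed_Collect_disj closed_Collect_eq continuous_intros
        continuous_on_product_coordinates)
  with compact_charges have "compact ({m. charge m} \<inter> {u :: 'a set \<Rightarrow> real. \<forall>A. u A = 0 \<or> u A = 1})"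
    by (rule compact_Int_closed)
  then show ?thesis by (simp add: ultrafilter_charge_def Collect_conj_eq)
qed

lemma ultrafilter_charge_inter:
  assumes "ultrafilter_charge u"
  shows "u (A \<inter> B) = 1 \<longleftrightarrow> u A = 1 \<and> u B = 1"
proof -
  have u: "charge u" using assms by (simp add: ultrafilter_charge_def)
  have "u B \<le> u (A \<inter> B) + u (- A)"
    using charge_mono[OF u, of B "(A \<inter> B) \<union> - A"] charge_union[OF u, of "A \<inter> B" "- A"] by auto
  moreover have "u (A \<inter> B) \<le> u A" "u (A \<inter> B) \<le> u B" by (auto intro: charge_mono[OF u])
  ultimately show ?thesis
    using charge_Compl[OF u, of A] charge_le_1[OF u, of A] charge_le_1[OF u, of B]
      charge_le_1[OF u, of "A \<inter> B"] by auto
qed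

definition ufilter :: "('a set \<Rightarrow> real) \<Rightarrow> 'a filter" where
  "ufilter u = Abs_filter (\<lambda>P. u {x. P x} = 1)"

lemma eventually_ufilter:
  assumes "ultrafilter_charge u"
  shows "eventually P (ufilter u) \<longleftrightarrow> u {x. P x} = 1"
  unfolding ufilter_def
proof (rule eventually_Abs_filter, standard)
  have u: "charge u" using assms by (simp add: ultrafilter_charge_def)
  show "u {x. True} = 1" using charge_UNIV[OF u] by simp
  show "u {x. P x \<and> Q x} = 1" if "u {x. P x} = 1" "u {x. Q x} = 1" for P Q
    using ultrafilter_charge_inter[OF assms] that by (simp add: Collect_conj_eq)
  show "u {x. Q x} = 1" if "\<forall>x. P x \<longrightarrow> Q x" "u {x. P x} = 1" for P Q
    using charge_mono[OF u, of "{x. P x}" "{x. Q x}"] charge_le_1[OF u, of "{x. Q x}"] that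
    by (simp add: subset_eq)
qed

lemma ufilter_not_bot:
  assumes "ultrafilter_charge u"
  shows "ufilter u \<noteq> bot"
  using eventually_ufilter[OF assms, of "\<lambda>_. False"] charge_empty[of u] assms
  by (auto simp: trivial_limit_def ultrafilter_charge_def)

lemma ufilter_ultra:
  assumes "ultrafilter_charge u"
  shows "eventually P (ufilter u) \<or> eventually (\<lambda>x. \<not> P x) (ufilter u)"
proof -
  have u: "charge u" "u {x. P x} = 0 \<or> u {x. P x} = 1" using assms by (auto simp: ultrafilter_charge_def)
  then show ?thesis
    using charge_Compl[OF u(1), of "{x. P x}"] unfolding eventually_ufilter[OF assms]
    by (auto simp: Collect_neg_eq)
qed

text \<open>Compactness of the interval gives a cluster point; since an ultrafilter decides every
  set, a cluster point is already a limit.\<close>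

lemma ufilter_convergent:
  fixes h :: "'a \<Rightarrow> real"
  assumes u: "ultrafilter_charge u" and h: "\<And>x. \<bar>h x\<bar> \<le> R"
  obtains l where "\<bar>l\<bar> \<le> R" "(h \<longlongrightarrow> l) (ufilter u)"
proof -
  have "filtermap h (ufilter u) \<noteq> bot"
    using ufilter_not_bot[OF u] by (simp add: filtermap_bot_iff)
  moreover have "eventually (\<lambda>x. x \<in> {-R..R}) (filtermap h (ufilter u))"
    using h by (simp add: eventually_filtermap abs_le_iff minus_le_iff)
  ultimately obtain l where l: "l \<in> {-R..R}" "inf (nhds l) (filtermap h (ufilter u)) \<noteq> bot"
    using compact_Icc[of "-R" R] unfolding compact_filter by blast
  have "(h \<longlongrightarrow> l) (ufilter u)"
  proof (rule topological_tendstoI)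
    fix S assume S: "open S" "l \<in> S"
    show "eventually (\<lambda>x. h x \<in> S) (ufilter u)"
    proof (rule ccontr)
      assume "\<not> ?thesis"
      then have "eventually (\<lambda>x. h x \<notin> S) (ufilter u)"
        using ufilter_ultra[OF u] by blast
      then have "eventually (\<lambda>x. x \<notin> S) (filtermap h (ufilter u))"
        by (simp add: eventually_filtermap)
      moreover have "eventually (\<lambda>x. x \<in> S) (nhds l)" using S by (rule eventually_nhds_in_open)
      ultimately have "eventually (\<lambda>_. False) (inf (nhds l) (filtermap h (ufilter u)))"
        unfolding eventually_inf by blast
      then show False using l by (simp add: trivial_limit_def)
    qed
  qed
  with l show thesis by (intro that) auto
qed

section \<open>The clopen algebra of the Stone space\<close>

definition stone_set :: "'a set \<Rightarrow> ('a set \<Rightarrow> real) set" where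
  "stone_set A = {u. ultrafilter_charge u \<and> u A = 1}"

lemma stone_set_Int: "stone_set (A \<inter> B) = stone_set A \<inter> stone_set B"
  by (auto simp: stone_set_def ultrafilter_charge_inter)

lemma stone_set_Compl: "stone_set (- A) = stone_set UNIV - stone_set A"
  by (auto simp: stone_set_def ultrafilter_charge_def charge_Compl charge_UNIV)

lemma stone_set_UNIV: "stone_set UNIV = {u. ultrafilter_charge u}"
  by (auto simp: stone_set_def ultrafilter_charge_def charge_UNIV)

lemma stone_set_empty: "stone_set {} = {}"
  by (auto simp: stone_set_def ultrafilter_charge_def charge_empty)

lemma stone_set_subset: "stone_set A \<subseteq> stone_set UNIV"
  by (auto simp: stone_set_UNIV) (auto simp: stone_set_def)

lemma stone_set_Diff: "stone_set (A - B) = stone_set A - stone_set B"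
  using stone_set_Int[of A "- B"] stone_set_Compl[of B] stone_set_subset[of A]
  by (auto simp: Diff_eq)

lemma stone_set_Un: "stone_set (A \<union> B) = stone_set A \<union> stone_set B"
proof -
  have "A \<union> B = - (- A \<inter> - B)" by auto
  then have "stone_set (A \<union> B) = stone_set (- (- A \<inter> - B))" by simp
  then show ?thesis
    using stone_set_subset[of A] stone_set_subset[of B]
    unfolding stone_set_Compl[of "- A \<inter> - B"] stone_set_Int stone_set_Compl[of A] stone_set_Compl[of B]
    by blast
qed

lemma stone_set_eq_empty_iff: "stone_set A = {} \<longleftrightarrow> A = {}"
proof
  assume e: "stone_set A = {}"
  \<comment> \<open>A point of \<open>A\<close> supplies its principal ultrafilter.\<close>
  have "(\<lambda>B. indicator B x) \<in> stone_set A" if "x \<in> A" for x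
    unfolding stone_set_def ultrafilter_charge_def using that charge_dirac[of x]
    by (auto split: split_indicator)
  with e show "A = {}" by blast
qed (simp add: stone_set_empty)

text \<open>A clopen set determines the subset it comes from, so a charge can be transported to the
  clopen algebra through \<open>inv stone_set\<close>.\<close>

lemma inj_stone_set: "inj stone_set"
proof (rule injI)
  fix A B :: "'a set" assume "stone_set A = stone_set B"
  then have "stone_set (A - B) = {}" "stone_set (B - A) = {}" by (auto simp: stone_set_Diff)
  then show "A = B" by (auto simp: stone_set_eq_empty_iff)
qed

text \<open>On the Stone space a finitely additive measure is a premeasure for free: by compactness, a
  decreasing sequence of clopen sets with empty intersection is eventually empty.\<close>

lemma stone_measure:
  assumes m: "charge m"
  obtains P where "finite_measure P" "space P = stone_set UNIV"
    "\<And>A. stone_set A \<in> sets P" "\<And>A. measure P (stone_set A) = m A"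
proof -
  let ?K = "stone_set UNIV :: ('a set \<Rightarrow> real) set"
  let ?R = "range stone_set :: ('a set \<Rightarrow> real) set set"
  define f where "f S = ennreal (m (inv stone_set S))" for S
  have f: "f (stone_set A) = ennreal (m A)" for A by (simp add: f_def inv_f_f[OF inj_stone_set])
  interpret ring_of_sets ?K ?R
  proof (rule ring_of_setsI)
    show "?R \<subseteq> Pow ?K" using stone_set_subset by blast
    show "{} \<in> ?R" using stone_set_empty by (metis rangeI)
  qed (auto simp flip: stone_set_Un stone_set_Diff)
  have "\<exists>\<mu>. (\<forall>S\<in>?R. \<mu> S = f S) \<and> measure_space ?K (sigma_sets ?K ?R) \<mu>"
  proof (rule caratheodory_empty_continuous)
    show "positive ?R f"
      using f[of "{}"] by (simp add: positive_def stone_set_empty charge_empty[OF m])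
    show "additive ?R f"
    proof (clarsimp simp: additive_def)
      fix A B :: "'a set" assume "stone_set A \<inter> stone_set B = {}"
      then have "A \<inter> B = {}" by (simp add: stone_set_eq_empty_iff flip: stone_set_Int)
      then show "f (stone_set A \<union> stone_set B) = f (stone_set A) + f (stone_set B)"
        by (simp add: f charge_union[OF m] charge_nonneg[OF m] flip: stone_set_Un)
    qed
    show "f S \<noteq> \<infinity>" if "S \<in> ?R" for S using that by (auto simp: f)
  next
    fix S :: "nat \<Rightarrow> ('a set \<Rightarrow> real) set"
    assume S: "range S \<subseteq> ?R" "decseq S" "(\<Inter>i. S i) = {}"
    then have "\<forall>i. \<exists>A. S i = stone_set A" by blast
    then obtain A where A: "\<And>i. S i = stone_set (A i)" by metis
    have "\<exists>n. S n = {}"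
    proof (rule ccontr)
      assume ne: "\<nexists>n. S n = {}"
      have "{u. ultrafilter_charge u} \<inter> (\<Inter>i\<in>UNIV. {u. u (A i) = 1}) \<noteq> {}"
      proof (rule compact_imp_fip_image[OF compact_ultrafilter_charges])
        show "closed {u. u (A i) = (1 :: real)}" for i
          by (intro closed_Collect_eq continuous_intros continuous_on_product_coordinates)
      next
        fix I :: "nat set" assume "finite I"
        then obtain n where n: "\<And>i. i \<in> I \<Longrightarrow> i \<le> n" by (meson finite_nat_set_iff_bounded_le)
        obtain u where "u \<in> S n" using ne by blast
        then have "u \<in> S i" if "i \<in> I" for i using decseqD[OF S(2) n[OF that]] by blast
        then have "u \<in> {u. ultrafilter_charge u} \<inter> (\<Inter>i\<in>I. {u. u (A i) = 1})"
          using \<open>u \<in> S n\<close> by (auto simp: A stone_set_def)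
        then show "{u. ultrafilter_charge u} \<inter> (\<Inter>i\<in>I. {u. u (A i) = 1}) \<noteq> {}" by blast
      qed
      then show False using S(3) by (auto simp: A stone_set_def)
    qed
    then obtain n where n: "S n = {}" by blast
    then have "f (S i) = 0" if "n \<le> i" for i
      using decseqD[OF S(2) that] f[of "{}"] by (simp add: stone_set_empty charge_empty[OF m])
    then show "(\<lambda>i. f (S i)) \<longlonglongrightarrow> 0"
      by (intro tendsto_eventually eventually_sequentiallyI)
  qed
  then obtain \<mu> where \<mu>: "\<And>S. S \<in> ?R \<Longrightarrow> \<mu> S = f S" "measure_space ?K (sigma_sets ?K ?R) \<mu>" by blast
  define P where "P = measure_of ?K ?R \<mu>"
  have sub: "?R \<subseteq> Pow ?K" using stone_set_subset by blast
  have sets: "sets P = sigma_sets ?K ?R" "space P = ?K" using sub by (auto simp: P_def)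
  have inP: "stone_set A \<in> sets P" for A by (auto simp: sets)
  have em: "emeasure P (stone_set A) = ennreal (m A)" for A
  proof -
    have "emeasure P (stone_set A) = \<mu> (stone_set A)"
      using \<mu>(2) sub sets inP by (intro emeasure_measure_of[OF P_def]) (auto simp: measure_space_def)
    then show ?thesis by (simp add: \<mu> f)
  qed
  show thesis
  proof (rule that)
    show "finite_measure P" by (rule finite_measureI) (simp add: sets em)
    show "measure P (stone_set A) = m A" for A by (simp add: measure_def em charge_nonneg[OF m])
  qed (auto simp: sets(2) inP)
qed

text \<open>The limits of \<open>H\<close> along ultrafilters extend \<open>H\<close> to the Stone
  space, and the strict superlevel sets of the extension are countable unions of clopen sets. The
  margins \<open>inverse (real (Suc n))\<close> are there because a strict inequality becomes a weak
  one in the limit.\<close>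

lemma stone_limit_measurable:
  fixes H :: "'a \<Rightarrow> real"
  assumes P: "space P = stone_set UNIV" "\<And>A. stone_set A \<in> sets P"
    and lim: "\<And>u. ultrafilter_charge u \<Longrightarrow> (H \<longlongrightarrow> H' u) (ufilter u)"
  shows "H' \<in> borel_measurable P"
  unfolding borel_measurable_iff_greater
proof
  fix r :: real
  have "{u \<in> space P. r < H' u} = (\<Union>n. stone_set {x. r + inverse (real (Suc n)) < H x})"
  proof (intro equalityI subsetI)
    fix u assume "u \<in> {u \<in> space P. r < H' u}"
    then have u: "ultrafilter_charge u" "r < H' u" by (auto simp: P stone_set_UNIV)
    then obtain n where "inverse (real (Suc n)) < H' u - r" using reals_Archimedean[of "H' u - r"] u(2) by auto
    then have "eventually (\<lambda>x. r + inverse (real (Suc n)) < H x) (ufilter u)"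
      using lim[OF u(1)] by (intro order_tendstoD(1)) auto
    then show "u \<in> (\<Union>n. stone_set {x. r + inverse (real (Suc n)) < H x})"
      using u unfolding eventually_ufilter[OF u(1)] by (auto simp: stone_set_def)
  next
    fix u assume "u \<in> (\<Union>n. stone_set {x. r + inverse (real (Suc n)) < H x})"
    then obtain n where u: "ultrafilter_charge u" "u {x. r + inverse (real (Suc n)) < H x} = 1"
      by (auto simp: stone_set_def)
    then have "eventually (\<lambda>x. r + inverse (real (Suc n)) < H x) (ufilter u)"
      by (simp add: eventually_ufilter)
    then have "eventually (\<lambda>x. r + inverse (real (Suc n)) \<le> H x) (ufilter u)"
      by eventually_elim simp
    then have "r + inverse (real (Suc n)) \<le> H' u"
      using tendsto_lowerbound[OF lim[OF u(1)]] ufilter_not_bot[OF u(1)] by blast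
    moreover have "0 < inverse (real (Suc n))" by simp
    ultimately have "r < H' u" by linarith
    then show "u \<in> {u \<in> space P. r < H' u}" using u by (auto simp: P stone_set_UNIV)
  qed
  then show "{u \<in> space P. r < H' u} \<in> sets P" using P(2) by auto
qed

section \<open>Upper sums against a charge\<close>

definition layer :: "real \<Rightarrow> ('a \<Rightarrow> real) \<Rightarrow> nat \<Rightarrow> 'a set" where
  "layer \<delta> H k = {x. real k * \<delta> \<le> H x \<and> H x < real (Suc k) * \<delta>}"

lemma layer_disjoint:
  assumes "0 < \<delta>" "x \<in> layer \<delta> H j" "x \<in> layer \<delta> H k"
  shows "j = k"
proof (rule ccontr)
  have x: "real j * \<delta> \<le> H x" "H x < real (Suc j) * \<delta>" "real k * \<delta> \<le> H x" "H x < real (Suc k) * \<delta>"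
    using assms(2,3) by (auto simp: layer_def)
  assume "j \<noteq> k"
  then consider "Suc j \<le> k" | "Suc k \<le> j" by linarith
  then show False
  proof cases
    case 1
    then have "real (Suc j) * \<delta> \<le> real k * \<delta>" using assms(1) by (intro mult_right_mono) auto
    with x show False by linarith
  next
    case 2
    then have "real (Suc k) * \<delta> \<le> real j * \<delta>" using assms(1) by (intro mult_right_mono) auto
    with x show False by linarith
  qed
qed

lemma layer_exists:
  assumes "0 < \<delta>" "0 \<le> H x" "H x < real N * \<delta>"
  obtains k where "k < N" "x \<in> layer \<delta> H k"
proof -
  define k where "k = nat \<lfloor>H x / \<delta>\<rfloor>"
  have k: "real k = of_int \<lfloor>H x / \<delta>\<rfloor>" using assms by (simp add: k_def)
  have "real k \<le> H x / \<delta>" "H x / \<delta> < real k + 1" unfolding k by linarith+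
  then have *: "real k * \<delta> \<le> H x" "H x < real (Suc k) * \<delta>" using assms(1) by (auto simp: field_simps)
  have "real k * \<delta> < real N * \<delta>" using * assms by linarith
  then have "k < N" using assms(1) by simp
  with * show thesis by (intro that) (auto simp: layer_def)
qed

text \<open>A substitute for the integral of \<open>H\<close> against \<open>m\<close> when
  \<open>H\<close> takes values below \<open>N * \<delta>\<close>. It evaluates \<open>m\<close> at
  finitely many sets, so it is affine and continuous in \<open>m\<close> for the product topology,
  as separation and compactness require.\<close>

definition upper_sum :: "real \<Rightarrow> nat \<Rightarrow> ('a \<Rightarrow> real) \<Rightarrow> ('a set \<Rightarrow> real) \<Rightarrow> real" where
  "upper_sum \<delta> N H m = (\<Sum>k<N. real (Suc k) * \<delta> * m (layer \<delta> H k))"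

text \<open>Taking the upper end of each band makes a point mass recover at least \<open>H x\<close>
  with no error term; the error is paid only on passing to the integral.\<close>

lemma upper_sum_dirac:
  assumes "0 < \<delta>" "0 \<le> H x" "H x < real N * \<delta>"
  shows "H x \<le> upper_sum \<delta> N H (\<lambda>A. indicator A x)"
proof -
  obtain k where k: "k < N" "x \<in> layer \<delta> H k" using layer_exists[of \<delta> H x N] assms by blast
  have "H x \<le> real (Suc k) * \<delta> * indicator (layer \<delta> H k) x"
    using k by (simp add: layer_def)
  also have "\<dots> \<le> upper_sum \<delta> N H (\<lambda>A. indicator A x)"
    unfolding upper_sum_def using k assms(1) by (intro member_le_sum) auto
  finally show ?thesis .
qed

lemma upper_sum_convex:
  "upper_sum \<delta> N H (\<lambda>A. (1 - \<tau>) * m A + \<tau> * m' A) =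
    (1 - \<tau>) * upper_sum \<delta> N H m + \<tau> * upper_sum \<delta> N H m'"
  unfolding upper_sum_def by (simp add: algebra_simps sum.distrib sum_distrib_left sum_subtractf)

lemma sum_layers_le_1:
  assumes m: "charge m" and \<delta>: "0 < \<delta>"
  shows "(\<Sum>k<N. m (layer \<delta> H k)) \<le> 1"
proof -
  have "(\<Sum>k<N. m (layer \<delta> H k)) = m (\<Union>k<N. layer \<delta> H k)"
  proof (induction N)
    case 0
    then show ?case by (simp add: charge_empty[OF m])
  next
    case (Suc N)
    have "layer \<delta> H N \<inter> (\<Union>k<N. layer \<delta> H k) = {}"
      using layer_disjoint[OF \<delta>] by fastforce
    then show ?case using Suc by (simp add: lessThan_Suc charge_union[OF m])
  qed
  then show ?thesis using charge_le_1[OF m] by simp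
qed

lemma upper_sum_bounds:
  assumes m: "charge m" and \<delta>: "0 < \<delta>"
  shows "0 \<le> upper_sum \<delta> N H m" "upper_sum \<delta> N H m \<le> real N * \<delta>"
proof -
  show "0 \<le> upper_sum \<delta> N H m"
    unfolding upper_sum_def using \<delta> charge_nonneg[OF m] by (intro sum_nonneg) auto
  have "upper_sum \<delta> N H m \<le> (\<Sum>k<N. real N * \<delta> * m (layer \<delta> H k))"
    unfolding upper_sum_def using \<delta> charge_nonneg[OF m] by (intro sum_mono mult_right_mono) auto
  also have "\<dots> = real N * \<delta> * (\<Sum>k<N. m (layer \<delta> H k))" by (simp add: sum_distrib_left)
  also have "\<dots> \<le> real N * \<delta>" using sum_layers_le_1[OF m \<delta>] \<delta> by (intro mult_left_le) auto
  finally show "upper_sum \<delta> N H m \<le> real N * \<delta>" .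
qed

text \<open>Lowering every band to its lower end costs \<open>\<delta>\<close> times the total mass
  of the layers, so at most \<open>\<delta>\<close>. The lowered sum is the integral of a step
  function on clopen sets, and this function lies below \<open>H'\<close>.\<close>

lemma upper_sum_le_integral:
  fixes H :: "'a \<Rightarrow> real"
  assumes m: "charge m" and \<delta>: "0 < \<delta>"
    and P: "finite_measure P" "space P = stone_set UNIV" "\<And>A. stone_set A \<in> sets P"
      "\<And>A. measure P (stone_set A) = m A"
    and H: "\<And>x. 0 \<le> H x" "\<And>x. H x \<le> R"
    and lim: "\<And>u. ultrafilter_charge u \<Longrightarrow> (H \<longlongrightarrow> H' u) (ufilter u)"
  shows "upper_sum \<delta> N H m \<le> (\<integral>u. H' u \<partial>P) + \<delta>"
proof -
  interpret finite_measure P by fact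
  have H': "0 \<le> H' u" "H' u \<le> R" if "ultrafilter_charge u" for u
    using tendsto_lowerbound[OF lim[OF that], of 0] tendsto_upperbound[OF lim[OF that], of R]
      ufilter_not_bot[OF that] H by auto
  have "H' \<in> borel_measurable P" using stone_limit_measurable[OF P(2,3) lim] .
  then have intH: "integrable P H'"
    using H' by (intro integrable_const_bound[where B = R]) (auto simp: P stone_set_UNIV)
  have int: "integrable P (\<lambda>u. real k * \<delta> * indicator (stone_set (layer \<delta> H k)) u)" for k
    using P(3) by (intro integrable_mult_right integrable_real_indicator) (auto simp: emeasure_eq_measure)
  have le: "(\<Sum>k<N. real k * \<delta> * indicator (stone_set (layer \<delta> H k)) u) \<le> H' u"
    if u: "ultrafilter_charge u" for u
  proof (cases "\<exists>k<N. u \<in> stone_set (layer \<delta> H k)")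
    case True
    then obtain k where k: "k < N" "u \<in> stone_set (layer \<delta> H k)" by blast
    have unique: "j = k" if "u \<in> stone_set (layer \<delta> H j)" for j
    proof (rule ccontr)
      assume "j \<noteq> k"
      then have "layer \<delta> H j \<inter> layer \<delta> H k = {}" using layer_disjoint[OF \<delta>, of _ H j k] by blast
      moreover have "u \<in> stone_set (layer \<delta> H j \<inter> layer \<delta> H k)"
        using that k(2) by (simp add: stone_set_Int)
      ultimately show False by (simp add: stone_set_empty)
    qed
    have "real j * \<delta> * indicator (stone_set (layer \<delta> H j)) u = (if j = k then real k * \<delta> else 0)" for j
    proof (cases "j = k")
      case False
      then have "u \<notin> stone_set (layer \<delta> H j)" using unique by blast
      with False show ?thesis by simp
    qed (use k in simp)
    then have "(\<Sum>j<N. real j * \<delta> * indicator (stone_set (layer \<delta> H j)) u) =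
        (\<Sum>j<N. if j = k then real k * \<delta> else 0)" by (simp only:)
    also have "\<dots> = real k * \<delta>" using k by simp
    also have "real k * \<delta> \<le> H' u"
    proof -
      \<comment> \<open>Membership of \<open>u\<close> in the clopen set says that the layer belongs
        to the ultrafilter, so the lower end of the band passes to the limit.\<close>
      have "eventually (\<lambda>x. x \<in> layer \<delta> H k) (ufilter u)"
        using k(2) by (simp add: eventually_ufilter[OF u] stone_set_def)
      then have "eventually (\<lambda>x. real k * \<delta> \<le> H x) (ufilter u)"
        by eventually_elim (simp add: layer_def)
      then show ?thesis using tendsto_lowerbound[OF lim[OF u]] ufilter_not_bot[OF u] by blast
    qed
    finally show ?thesis .
  next
    case False
    then have "(\<Sum>k<N. real k * \<delta> * indicator (stone_set (layer \<delta> H k)) u) = 0"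
      by (intro sum.neutral) auto
    then show ?thesis using H' u by simp
  qed
  have "upper_sum \<delta> N H m = (\<Sum>k<N. real k * \<delta> * m (layer \<delta> H k)) + \<delta> * (\<Sum>k<N. m (layer \<delta> H k))"
    unfolding upper_sum_def by (simp add: algebra_simps sum.distrib sum_distrib_left)
  also have "(\<Sum>k<N. real k * \<delta> * m (layer \<delta> H k)) =
      (\<integral>u. (\<Sum>k<N. real k * \<delta> * indicator (stone_set (layer \<delta> H k)) u) \<partial>P)"
  proof -
    have "(\<integral>u. (\<Sum>k<N. real k * \<delta> * indicator (stone_set (layer \<delta> H k)) u) \<partial>P) =
        (\<Sum>k<N. \<integral>u. real k * \<delta> * indicator (stone_set (layer \<delta> H k)) u \<partial>P)"
      by (rule Bochner_Integration.integral_sum) (rule int)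
    also have "\<dots> = (\<Sum>k<N. real k * \<delta> * m (layer \<delta> H k))"
      by (intro sum.cong refl) (simp add: P(3,4) sets.Int_space_eq2)
    finally show ?thesis by simp
  qed
  also have "\<dots> \<le> (\<integral>u. H' u \<partial>P)"
  proof (rule integral_mono)
    show "integrable P (\<lambda>u. \<Sum>k<N. real k * \<delta> * indicator (stone_set (layer \<delta> H k)) u)"
      by (rule Bochner_Integration.integrable_sum) (rule int)
  qed (use intH le in \<open>auto simp only: P stone_set_UNIV mem_Collect_eq\<close>)
  finally show ?thesis using sum_layers_le_1[OF m \<delta>, where N = N and H = H] \<delta> mult_left_le[of "\<Sum>k<N. m (layer \<delta> H k)" \<delta>]
    by linarith
qed

section \<open>Separation and domination on the predual\<close>

text \<open>Instead of a nearest point, which may not exist, the separating functional is built from an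
  almost nearest one.\<close>

lemma separate_point_from_convex:
  fixes T :: "('i \<Rightarrow> real) set" and v :: "'i \<Rightarrow> real"
  assumes I: "finite I" and ne: "T \<noteq> {}"
    and convex: "\<And>s t \<tau>. s \<in> T \<Longrightarrow> t \<in> T \<Longrightarrow> 0 \<le> \<tau> \<Longrightarrow> \<tau> \<le> 1 \<Longrightarrow> (\<lambda>i. (1 - \<tau>) * s i + \<tau> * t i) \<in> T"
    and bound: "\<And>t i. t \<in> T \<Longrightarrow> i \<in> I \<Longrightarrow> \<bar>t i\<bar> \<le> R i"
    and \<epsilon>: "0 < \<epsilon>" and far: "\<And>t. t \<in> T \<Longrightarrow> \<exists>i\<in>I. \<epsilon> \<le> \<bar>v i - t i\<bar>"
  obtains w c where "0 < c" "\<And>t. t \<in> T \<Longrightarrow> c \<le> (\<Sum>i\<in>I. w i * (v i - t i))"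
proof -
  define D where "D t = (\<Sum>i\<in>I. (v i - t i)\<^sup>2)" for t
  define B where "B = (\<Sum>i\<in>I. (2 * R i)\<^sup>2) + \<epsilon>\<^sup>2"
  \<comment> \<open>The length of a step from the almost nearest point \<open>s\<close> towards
    \<open>t\<close>. It is chosen so that the quadratic term \<open>\<tau>\<^sup>2 * B\<close>
    equals \<open>\<tau> * \<epsilon>\<^sup>2 / 2\<close>, which is also the tolerance allowed for
    \<open>s\<close>. The two together bound the inner product \<open>X\<close> by
    \<open>\<epsilon>\<^sup>2 / 2\<close>, half of the least squared distance. The summand
    \<open>\<epsilon>\<^sup>2\<close> in \<open>B\<close> guarantees
    \<open>\<tau> \<le> 1\<close>.\<close>
  define \<tau> where "\<tau> = \<epsilon>\<^sup>2 / (2 * B)"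
  have B: "\<epsilon>\<^sup>2 \<le> B" "0 < B" using \<epsilon> by (auto simp: B_def sum_nonneg add_nonneg_pos)
  have \<tau>: "0 < \<tau>" "\<tau> \<le> 1" "\<tau> * B = \<epsilon>\<^sup>2 / 2"
    using B \<epsilon> by (auto simp: \<tau>_def field_simps)
  have D\<epsilon>: "\<epsilon>\<^sup>2 \<le> D t" if t: "t \<in> T" for t
  proof -
    obtain i where i: "i \<in> I" "\<epsilon> \<le> \<bar>v i - t i\<bar>" using far[OF t] by blast
    then have "\<epsilon>\<^sup>2 \<le> (v i - t i)\<^sup>2" using \<epsilon> by (metis abs_le_square_iff abs_of_pos)
    also have "\<dots> \<le> D t" unfolding D_def using I i(1) by (intro member_le_sum) auto
    finally show ?thesis .
  qed
  have bdd: "bdd_below (D ` T)" by (rule bdd_belowI2[OF D\<epsilon>])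
  have "\<exists>s\<in>T. D s < Inf (D ` T) + \<tau> * \<epsilon>\<^sup>2 / 2"
    using cInf_lessD[of "D ` T" "Inf (D ` T) + \<tau> * \<epsilon>\<^sup>2 / 2"] ne \<tau> \<epsilon> by auto
  then obtain s where s: "s \<in> T" "D s < Inf (D ` T) + \<tau> * \<epsilon>\<^sup>2 / 2" by blast
  have "\<epsilon>\<^sup>2 / 2 \<le> (\<Sum>i\<in>I. (v i - s i) * (v i - t i))" if t: "t \<in> T" for t
  proof -
    define X where "X = (\<Sum>i\<in>I. (v i - s i) * (t i - s i))"
    define Y where "Y = (\<Sum>i\<in>I. (t i - s i)\<^sup>2)"
    have "Y \<le> (\<Sum>i\<in>I. (2 * R i)\<^sup>2)"
      unfolding Y_def
    proof (rule sum_mono)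
      fix i assume "i \<in> I"
      then have "\<bar>t i - s i\<bar> \<le> 2 * R i" using bound[OF t] bound[OF s(1)] by fastforce
      then show "(t i - s i)\<^sup>2 \<le> (2 * R i)\<^sup>2" by (metis abs_ge_self abs_le_square_iff order_trans)
    qed
    then have Y: "Y \<le> B" unfolding B_def using zero_le_power2[of \<epsilon>] by linarith
    have "D (\<lambda>i. (1 - \<tau>) * s i + \<tau> * t i) = D s - 2 * \<tau> * X + \<tau>\<^sup>2 * Y"
    proof -
      have "D (\<lambda>i. (1 - \<tau>) * s i + \<tau> * t i) = (\<Sum>i\<in>I. (v i - s i)\<^sup>2 +
          (- 2 * \<tau>) * ((v i - s i) * (t i - s i)) + \<tau>\<^sup>2 * (t i - s i)\<^sup>2)"
        unfolding D_def by (intro sum.cong refl) (simp add: power2_eq_square algebra_simps)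
      also have "\<dots> = D s + (- 2 * \<tau>) * X + \<tau>\<^sup>2 * Y"
        unfolding D_def X_def Y_def by (simp only: sum.distrib sum_distrib_left)
      finally show ?thesis by simp
    qed
    moreover have "Inf (D ` T) \<le> D (\<lambda>i. (1 - \<tau>) * s i + \<tau> * t i)"
      using convex[OF s(1) t] \<tau> bdd by (intro cInf_lower) auto
    ultimately have "2 * \<tau> * X \<le> \<tau>\<^sup>2 * Y + \<tau> * \<epsilon>\<^sup>2 / 2" using s(2) by linarith
    also have "\<tau>\<^sup>2 * Y \<le> \<tau>\<^sup>2 * B" using Y by (intro mult_left_mono) auto
    also have "\<tau>\<^sup>2 * B = \<tau> * \<epsilon>\<^sup>2 / 2" using \<tau>(3) by (simp add: power2_eq_square mult.assoc)
    finally have "\<tau> * X \<le> \<tau> * (\<epsilon>\<^sup>2 / 2)" by simp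
    then have "X \<le> \<epsilon>\<^sup>2 / 2" using \<tau> by simp
    moreover have "(\<Sum>i\<in>I. (v i - s i) * (v i - t i)) = D s - X"
      unfolding D_def X_def sum_subtractf[symmetric]
      by (intro sum.cong) (auto simp: power2_eq_square algebra_simps)
    ultimately show ?thesis using D\<epsilon>[OF s(1)] by linarith
  qed
  then show thesis using \<epsilon> by (intro that[of "\<epsilon>\<^sup>2 / 2" "\<lambda>i. v i - s i"]) auto
qed

text \<open>Where a weight is negative, solidity lets the coordinate of \<open>t\<close> be set to
  zero, and the remaining term is nonpositive because \<open>v i\<close> is nonnegative there. So
  negative weights may be replaced by zero. Nonnegativity is needed because p-th roots of the
  weights are taken later.\<close>

lemma separate_point_from_solid_convex:
  fixes T :: "('i \<Rightarrow> real) set" and v :: "'i \<Rightarrow> real"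
  assumes I: "finite I" and ne: "T \<noteq> {}"
    and convex: "\<And>s t \<tau>. s \<in> T \<Longrightarrow> t \<in> T \<Longrightarrow> 0 \<le> \<tau> \<Longrightarrow> \<tau> \<le> 1 \<Longrightarrow> (\<lambda>i. (1 - \<tau>) * s i + \<tau> * t i) \<in> T"
    and solid: "\<And>t J. t \<in> T \<Longrightarrow> (\<lambda>i. if i \<in> J then t i else 0) \<in> T"
    and bound: "\<And>t i. t \<in> T \<Longrightarrow> i \<in> I \<Longrightarrow> \<bar>t i\<bar> \<le> R i"
    and v: "\<And>i. i \<in> I \<Longrightarrow> 0 \<le> v i"
    and \<epsilon>: "0 < \<epsilon>" and far: "\<And>t. t \<in> T \<Longrightarrow> \<exists>i\<in>I. \<epsilon> \<le> \<bar>v i - t i\<bar>"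
  obtains w c where "0 < c" "\<And>i. 0 \<le> w i" "\<And>t. t \<in> T \<Longrightarrow> c \<le> (\<Sum>i\<in>I. w i * (v i - t i))"
proof -
  obtain w c where w: "0 < c" "\<And>t. t \<in> T \<Longrightarrow> c \<le> (\<Sum>i\<in>I. w i * (v i - t i))"
    by (rule separate_point_from_convex[where T = T and v = v and R = R, OF I ne _ _ \<epsilon>])
      (rule convex bound far | assumption | blast)+
  have "c \<le> (\<Sum>i\<in>I. max 0 (w i) * (v i - t i))" if "t \<in> T" for t
  proof -
    let ?t = "\<lambda>i. if i \<in> {i. 0 \<le> w i} then t i else 0"
    have "c \<le> (\<Sum>i\<in>I. w i * (v i - ?t i))" using solid[OF that] by (rule w(2))
    also have "\<dots> \<le> (\<Sum>i\<in>I. max 0 (w i) * (v i - t i))"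
      using v by (intro sum_mono) (auto simp: max_def mult_nonpos_nonneg)
    finally show ?thesis .
  qed
  with w(1) show thesis by (intro that[of c "\<lambda>i. max 0 (w i)"]) auto
qed

section \<open>The predual as a weak-star dense part of the bidual\<close>

locale dual_space =
  fixes J :: "'x::banach \<Rightarrow> ('y::banach \<Rightarrow>\<^sub>L real)"
  assumes dual: "isometric_isomorphism J"
begin

lemma linear_J: "linear J" and surj_J: "surj J" and norm_J: "norm (J x) = norm x"
  using dual by (auto simp: isometric_isomorphism_def)

lemma J_add: "J (x + x') = J x + J x'" and J_diff: "J (x - x') = J x - J x'"
  and J_scaleR: "J (c *\<^sub>R x) = c *\<^sub>R J x" and J_zero: "J 0 = 0"
  and J_sum: "J (sum g A) = (\<Sum>a\<in>A. J (g a))"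
  using linear_J by (auto simp: linear_add linear_diff linear_scale linear_0 linear_sum)

lemma inj_J: "J x = J x' \<Longrightarrow> x = x'"
  using norm_J[of "x - x'"] by (simp add: J_diff)

lemma abs_J_le: "\<bar>J x y\<bar> \<le> norm x * norm y"
  using norm_blinfun[of "J x" y] by (simp add: norm_J)

definition predual_embedding :: "'y \<Rightarrow> 'x \<Rightarrow>\<^sub>L real" where
  "predual_embedding y = Blinfun (\<lambda>x. J x y)"

lemma predual_embedding_apply [simp]: "predual_embedding y x = J x y"
proof -
  have "bounded_linear (\<lambda>x. J x y)"
    using abs_J_le
    by (intro bounded_linear_intro[where K = "norm y"])
      (auto simp: J_add J_scaleR blinfun.add_left blinfun.scaleR_left)
  then show ?thesis by (simp add: predual_embedding_def bounded_linear_Blinfun_apply)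
qed

lemma norm_predual_embedding_le: "norm (predual_embedding y) \<le> norm y"
  using abs_J_le by (intro norm_blinfun_bound) (auto simp: mult.commute)

lemma norming:
  assumes "0 < e"
  obtains y where "norm y \<le> 1" "norm x - e \<le> J x y"
proof -
  have "\<exists>y. norm y \<le> 1 \<and> norm x - e \<le> J x y"
  proof (rule ccontr)
    assume "\<not> ?thesis"
    then have lt: "J x y < norm x - e" if "norm y \<le> 1" for y using that by force
    then have "0 < norm x - e" using lt[of 0] by simp
    moreover have "norm (J x y) \<le> (norm x - e) * norm y" for y
    proof (cases "y = 0")
      case False
      then have "J x (y /\<^sub>R norm y) < norm x - e" "J x (- (y /\<^sub>R norm y)) < norm x - e"
        by (auto intro!: lt)
      then show ?thesis
        using False by (auto simp: blinfun.minus_right blinfun.scaleR_right abs_le_iff field_simps)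
    qed simp
    ultimately have "norm (J x) \<le> norm x - e" by (intro norm_blinfun_bound) auto
    then show False using assms by (simp add: norm_J)
  qed
  then show thesis using that by blast
qed

text \<open>Goldstine's theorem on finitely many coordinates. Separating weights combine into one
  vector \<open>z\<close> of \<open>X\<close> whose pairings with the ball of radius
  \<open>R\<close> in \<open>Y\<close> would stay below \<open>R * norm z\<close> by a fixed amount,
  although that ball norms \<open>z\<close>.\<close>

lemma Goldstine_predual:
  fixes \<phi> :: "'x \<Rightarrow>\<^sub>L real"
  assumes I: "finite I" and \<epsilon>: "0 < \<epsilon>" and \<phi>: "norm \<phi> \<le> R" and R: "0 < R"
  obtains y where "norm y \<le> R" "\<And>x. x \<in> I \<Longrightarrow> \<bar>\<phi> x - J x y\<bar> < \<epsilon>"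
proof -
  let ?T = "(\<lambda>y x. J x y) ` cball 0 R"
  have "\<exists>t\<in>?T. \<forall>x\<in>I. \<bar>\<phi> x - t x\<bar> < \<epsilon>"
  proof (rule ccontr)
    assume "\<not> ?thesis"
    then have far: "\<exists>x\<in>I. \<epsilon> \<le> \<bar>\<phi> x - t x\<bar>" if "t \<in> ?T" for t using that by force
    have convex: "(\<lambda>x. (1 - \<tau>) * s x + \<tau> * t x) \<in> ?T"
      if st: "s \<in> ?T" "t \<in> ?T" and \<tau>: "0 \<le> \<tau>" "\<tau> \<le> 1" for s t \<tau>
    proof -
      obtain y z where y: "s = (\<lambda>x. J x y)" "t = (\<lambda>x. J x z)" "y \<in> cball 0 R" "z \<in> cball 0 R"
        using st by blast
      have "(1 - \<tau>) *\<^sub>R y + \<tau> *\<^sub>R z \<in> cball 0 R"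
        using convex_cball[of 0 R] y \<tau> by (intro convexD) auto
      then show ?thesis
        by (intro image_eqI[of _ _ "(1 - \<tau>) *\<^sub>R y + \<tau> *\<^sub>R z"])
          (auto simp: y blinfun.add_right blinfun.scaleR_right)
    qed
    have bound: "\<bar>t x\<bar> \<le> norm x * R" if t: "t \<in> ?T" for t x
    proof -
      obtain y where y: "t = (\<lambda>x. J x y)" "norm y \<le> R" using t by auto
      then show ?thesis using abs_J_le[of x y] mult_left_mono[OF y(2), of "norm x"] by simp
    qed
    have ne: "?T \<noteq> {}" using R by auto
    obtain w c where w: "0 < c" "\<And>t. t \<in> ?T \<Longrightarrow> c \<le> (\<Sum>x\<in>I. w x * (\<phi> x - t x))"
      by (rule separate_point_from_convex[where T = ?T and v = "blinfun_apply \<phi>" and R = "\<lambda>x. norm x * R",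
            OF I ne _ _ \<epsilon>])
        (rule convex bound far | assumption | blast)+
    define z where "z = (\<Sum>x\<in>I. w x *\<^sub>R x)"
    have le: "J z y \<le> R * norm z - c" if "norm y \<le> R" for y
    proof -
      have "c \<le> (\<Sum>x\<in>I. w x * (\<phi> x - J x y))" using that by (intro w(2)) auto
      also have "\<dots> = \<phi> z - J z y"
        by (simp add: z_def J_sum J_scaleR blinfun.sum_left blinfun.sum_right blinfun.scaleR_left
            blinfun.scaleR_right algebra_simps sum_subtractf)
      also have "\<phi> z \<le> R * norm z"
        using norm_blinfun[of \<phi> z] mult_right_mono[OF \<phi>, of "norm z"] by simp
      finally show ?thesis by simp
    qed
    \<comment> \<open>After scaling by \<open>R\<close> this slack is \<open>c / 2\<close>, still
      smaller than the gap \<open>c\<close>.\<close>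
    obtain y where y: "norm y \<le> 1" "norm z - c / (2 * R) \<le> J z y"
      using norming[of "c / (2 * R)" z] w(1) R by auto
    have "J z (R *\<^sub>R y) \<le> R * norm z - c" using y(1) R by (intro le) (simp add: mult_left_le)
    moreover have "R * (norm z - c / (2 * R)) \<le> R * J z y" using y(2) R by (intro mult_left_mono) auto
    moreover have "R * (norm z - c / (2 * R)) = R * norm z - c / 2" using R by (simp add: field_simps)
    moreover have "J z (R *\<^sub>R y) = R * J z y" by (simp add: blinfun.scaleR_right)
    ultimately show False using w(1) by linarith
  qed
  then show thesis using that by auto
qed

lemma Hw_le_on_predual:
  assumes f: "f \<in> Hw" and g: "g \<in> Hw"
    and le: "\<And>y. f (predual_embedding y) \<le> g (predual_embedding y)"
  shows "f \<phi> \<le> g \<phi>"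
proof (rule ccontr)
  assume "\<not> f \<phi> \<le> g \<phi>"
  \<comment> \<open>Continuity is available on bounded sets only, so one ball has to contain
    \<open>\<phi>\<close> and all the approximating elements of the predual; the \<open>+ 1\<close>
    makes its radius positive.\<close>
  define R where "R = norm \<phi> + 1"
  have R: "0 < R" "norm \<phi> \<le> R" by (auto simp: R_def add_nonneg_pos)
  let ?X = "subtopology weak_star_topology (cball 0 R)"
  have "continuous_map ?X euclideanreal (\<lambda>\<psi>. f \<psi> - g \<psi>)"
    using f g by (intro continuous_intros Hw_continuous_map) auto
  then have "openin ?X {\<psi> \<in> topspace ?X. f \<psi> - g \<psi> \<in> {0<..}}"
    by (rule openin_continuous_map_preimage) auto
  then obtain U where U: "openin weak_star_topology U"
    "{\<psi> \<in> topspace ?X. f \<psi> - g \<psi> \<in> {0<..}} = U \<inter> cball 0 R"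
    unfolding openin_subtopology by blast
  have "\<phi> \<in> {\<psi> \<in> topspace ?X. f \<psi> - g \<psi> \<in> {0<..}}"
    using \<open>\<not> f \<phi> \<le> g \<phi>\<close> R by (simp add: strong_operator_topology_topspace)
  then have "\<phi> \<in> U" using U by blast
  obtain V where V: "open V" "U = blinfun_apply -` V"
    using U(1) unfolding strong_operator_topology_def openin_pullback_topology by auto
  have "openin (product_topology (\<lambda>_. euclidean) UNIV) V"
    using V(1) by (simp add: euclidean_product_topology)
  moreover have "blinfun_apply \<phi> \<in> V" using V \<open>\<phi> \<in> U\<close> by auto
  ultimately obtain W where W: "blinfun_apply \<phi> \<in> PiE UNIV W" "\<And>x. open (W x)"
      "finite {x. W x \<noteq> UNIV}" "PiE UNIV W \<subseteq> V"
    using product_topology_open_contains_basis[of "\<lambda>_. euclidean" UNIV V "blinfun_apply \<phi>"] by auto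
  define I where "I = {x. W x \<noteq> UNIV}"
  have "\<forall>x. \<exists>e>0. \<forall>r. \<bar>\<phi> x - r\<bar> < e \<longrightarrow> r \<in> W x"
  proof
    fix x
    have "\<phi> x \<in> W x" using W(1) by auto
    then show "\<exists>e>0. \<forall>r. \<bar>\<phi> x - r\<bar> < e \<longrightarrow> r \<in> W x"
      using W(2)[of x] unfolding open_dist dist_real_def by (metis abs_minus_commute)
  qed
  then obtain e where e: "\<And>x. 0 < e x" "\<And>x r. \<bar>\<phi> x - r\<bar> < e x \<Longrightarrow> r \<in> W x" by metis
  \<comment> \<open>A basic neighbourhood restricts finitely many coordinates, so one tolerance
    serves all of them; \<open>insert 1\<close> covers the case of no restriction.\<close>
  define \<epsilon> where "\<epsilon> = Min (insert 1 (e ` I))"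
  have fin: "finite I" using W(3) by (simp add: I_def)
  have \<epsilon>: "0 < \<epsilon>" "\<And>x. x \<in> I \<Longrightarrow> \<epsilon> \<le> e x" using e(1) fin by (auto simp: \<epsilon>_def)
  obtain y where y: "norm y \<le> R" "\<And>x. x \<in> I \<Longrightarrow> \<bar>\<phi> x - J x y\<bar> < \<epsilon>"
    using Goldstine_predual[OF fin \<epsilon>(1) R(2,1)] by blast
  have "J x y \<in> W x" for x
  proof (cases "x \<in> I")
    case True
    show ?thesis using y(2)[OF True] \<epsilon>(2)[OF True] by (intro e(2)) linarith
  qed (simp add: I_def)
  then have "blinfun_apply (predual_embedding y) \<in> PiE UNIV W" by auto
  then have "predual_embedding y \<in> U \<inter> cball 0 R"
    using V W(4) norm_predual_embedding_le[of y] y(1) by auto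
  then show False using le[of y] U(2) by force
qed

text \<open>Points outside the unit ball are sent to \<open>0\<close>, so that the pairing is bounded on all of \<open>'x\<close>.\<close>

definition ball_pairing :: "'y \<Rightarrow> 'x \<Rightarrow> real" where
  "ball_pairing y x = (if norm x \<le> 1 then J x y else 0)"

lemma abs_ball_pairing_le: "\<bar>ball_pairing y x\<bar> \<le> norm y"
  using abs_J_le[of x y] mult_right_mono[of "norm x" 1 "norm y"] by (auto simp: ball_pairing_def)

text \<open>Alaoglu's theorem along an ultrafilter: the coordinatewise limits form a functional on
  the predual of norm at most \<open>1\<close>, and surjectivity of \<open>J\<close> turns it into a
  point of \<open>X\<close>.\<close>

lemma weak_star_limit:
  assumes u: "ultrafilter_charge u"
  shows "\<exists>x. norm x \<le> 1 \<and> (\<forall>y. (ball_pairing y \<longlongrightarrow> J x y) (ufilter u))"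
proof -
  have "\<exists>l. \<bar>l\<bar> \<le> norm y \<and> (ball_pairing y \<longlongrightarrow> l) (ufilter u)" for y
    by (rule ufilter_convergent[OF u, of "ball_pairing y" "norm y"]) (auto simp: abs_ball_pairing_le)
  then obtain L where L: "\<And>y. \<bar>L y\<bar> \<le> norm y" "\<And>y. (ball_pairing y \<longlongrightarrow> L y) (ufilter u)"
    using choice[of "\<lambda>y l. \<bar>l\<bar> \<le> norm y \<and> (ball_pairing y \<longlongrightarrow> l) (ufilter u)"] by blast
  have "L (y + z) = L y + L z" for y z
  proof (rule tendsto_unique[OF ufilter_not_bot[OF u] L(2)])
    have "ball_pairing (y + z) = (\<lambda>x. ball_pairing y x + ball_pairing z x)"
      by (auto simp: ball_pairing_def blinfun.add_right)
    then show "(ball_pairing (y + z) \<longlongrightarrow> L y + L z) (ufilter u)" using tendsto_add[OF L(2) L(2)] by simp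
  qed
  moreover have "L (c *\<^sub>R y) = c *\<^sub>R L y" for c y
  proof (rule tendsto_unique[OF ufilter_not_bot[OF u] L(2)])
    have "ball_pairing (c *\<^sub>R y) = (\<lambda>x. c *\<^sub>R ball_pairing y x)"
      by (auto simp: ball_pairing_def blinfun.scaleR_right)
    then show "(ball_pairing (c *\<^sub>R y) \<longlongrightarrow> c *\<^sub>R L y) (ufilter u)"
      using tendsto_scaleR[OF tendsto_const L(2)] by simp
  qed
  ultimately have bl: "bounded_linear L"
    using L(1) by (intro bounded_linear_intro[where K = 1]) simp_all
  obtain x where x: "Blinfun L = J x" using surjD[OF surj_J, of "Blinfun L"] by (elim exE)
  have Jx: "J x y = L y" for y by (simp add: x[symmetric] bounded_linear_Blinfun_apply[OF bl])
  have "norm (J x) \<le> 1" using L(1) by (intro norm_blinfun_bound) (auto simp: Jx)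
  moreover have "(ball_pairing y \<longlongrightarrow> J x y) (ufilter u)" for y unfolding Jx by (rule L(2))
  ultimately show ?thesis unfolding norm_J by blast
qed

text \<open>If no charge works, separating the values of \<open>f\<close> from the attainable upper
  sums gives nonnegative weights with a gap \<open>c\<close>. Point masses then bound the weak
  p-norm of the weighted functionals by \<open>(V - c) powr (1 / p)\<close>, whereas the p-sum of
  \<open>f\<close> over them is \<open>V\<close>. This contradicts
  \<open>p_bounded_by p 1 f\<close>.\<close>

lemma dominating_charge_finite:
  fixes I :: "('y \<times> real) set"
  assumes p: "1 \<le> p" and hom: "\<And>c \<phi>. 0 \<le> c \<Longrightarrow> f (c *\<^sub>R \<phi>) = c * f \<phi>"
    and nonneg: "\<And>\<phi>. 0 \<le> f \<phi>" and bound: "p_bounded_by p 1 f"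
    and I: "finite I" and \<delta>: "\<And>y \<delta>. (y, \<delta>) \<in> I \<Longrightarrow> 0 < \<delta>"
    and N: "\<And>y \<delta>. (y, \<delta>) \<in> I \<Longrightarrow> norm y powr p < real (N y \<delta>) * \<delta>"
  shows "\<exists>m. charge m \<and> (\<forall>(y, \<delta>)\<in>I.
    f (predual_embedding y) powr p \<le> upper_sum \<delta> (N y \<delta>) (\<lambda>x. \<bar>ball_pairing y x\<bar> powr p) m + \<delta>)"
proof (rule ccontr)
  assume contra: "\<not> ?thesis"
  define S where "S i = upper_sum (snd i) (N (fst i) (snd i)) (\<lambda>x. \<bar>ball_pairing (fst i) x\<bar> powr p)" for i
  define v where "v i = f (predual_embedding (fst i)) powr p" for i :: "'y \<times> real"
  define \<epsilon> where "\<epsilon> = Min (insert 1 (snd ` I))"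
  have \<epsilon>: "0 < \<epsilon>" "\<And>i. i \<in> I \<Longrightarrow> \<epsilon> \<le> snd i" using I \<delta> by (auto simp: \<epsilon>_def)
  \<comment> \<open>Taking everything between zero and the upper sums, and not only the upper sums,
    makes \<open>T\<close> solid; convexity holds because upper sums are affine in the
    charge.\<close>
  define T where "T = {t. \<exists>m. charge m \<and> (\<forall>i. 0 \<le> t i) \<and> (\<forall>i\<in>I. t i \<le> S i m)}"
  have S0: "0 \<le> S i m" "S i m \<le> real (N (fst i) (snd i)) * snd i" if "charge m" "i \<in> I" for i m
    using upper_sum_bounds[OF that(1) \<delta>[of "fst i" "snd i"]] that(2) by (auto simp: S_def)
  have far: "\<exists>i\<in>I. \<epsilon> \<le> \<bar>v i - t i\<bar>" if t: "t \<in> T" for t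
  proof -
    obtain m where m: "charge m" "\<And>i. i \<in> I \<Longrightarrow> t i \<le> S i m" using t by (auto simp: T_def)
    then obtain y \<delta>' where i: "(y, \<delta>') \<in> I" "\<not> v (y, \<delta>') \<le> S (y, \<delta>') m + \<delta>'"
      using contra by (auto simp: v_def S_def)
    then show ?thesis using m(2)[OF i(1)] \<epsilon>(2)[OF i(1)] by (intro bexI[OF _ i(1)]) auto
  qed
  \<comment> \<open>Nonnegativity in \<open>T\<close> is asked at every index, while outside
    \<open>I\<close> the band width, and with it the upper sum, may be negative; hence
    \<open>max 0\<close>.\<close>
  have T_I: "(\<lambda>i. max 0 (S i m)) \<in> T" if "charge m" for m
    using that S0 by (auto simp: T_def max_def)
  from T_I[OF charge_dirac] have ne: "T \<noteq> {}" by (rule ex_in_conv[THEN iffD1, OF exI])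
  have convex: "(\<lambda>i. (1 - \<tau>) * s i + \<tau> * t i) \<in> T"
    if st: "s \<in> T" "t \<in> T" and \<tau>: "0 \<le> \<tau>" "\<tau> \<le> 1" for s t \<tau>
  proof -
    obtain m m' where m: "charge m" "\<And>i. 0 \<le> s i" "\<And>i. i \<in> I \<Longrightarrow> s i \<le> S i m"
      and m': "charge m'" "\<And>i. 0 \<le> t i" "\<And>i. i \<in> I \<Longrightarrow> t i \<le> S i m'"
      using st by (auto simp: T_def)
    have "(1 - \<tau>) * s i + \<tau> * t i \<le> S i (\<lambda>A. (1 - \<tau>) * m A + \<tau> * m' A)" if "i \<in> I" for i
      unfolding S_def upper_sum_convex
      using m(3)[OF that] m'(3)[OF that] \<tau> unfolding S_def by (intro add_mono mult_left_mono) auto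
    then show ?thesis
      unfolding T_def using charge_convex[OF m(1) m'(1) \<tau>] m(2) m'(2) \<tau> by auto
  qed
  have solid: "(\<lambda>i. if i \<in> A then t i else 0) \<in> T" if "t \<in> T" for t A
    using that S0 by (auto simp: T_def)
  have Tb: "\<bar>t i\<bar> \<le> real (N (fst i) (snd i)) * snd i" if t: "t \<in> T" "i \<in> I" for t i
  proof -
    obtain m where m: "charge m" "0 \<le> t i" "t i \<le> S i m" using t unfolding T_def by blast
    show ?thesis using m(2,3) S0(2)[OF m(1) t(2)] by linarith
  qed
  have v0: "0 \<le> v i" for i by (simp add: v_def)
  obtain w c where w: "0 < c" "\<And>i. 0 \<le> w i" "\<And>t. t \<in> T \<Longrightarrow> c \<le> (\<Sum>i\<in>I. w i * (v i - t i))"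
    by (rule separate_point_from_solid_convex[where T = T and v = v and
          R = "\<lambda>i. real (N (fst i) (snd i)) * snd i", OF I ne _ _ _ _ \<epsilon>(1)])
      (rule convex solid Tb far v0 | assumption | blast)+
  define V where "V = (\<Sum>i\<in>I. w i * v i)"
  \<comment> \<open>Separation is used for point masses only; the resulting bound is uniform over
    the ball.\<close>
  have J_le: "(\<Sum>i\<in>I. w i * \<bar>J x (fst i)\<bar> powr p) \<le> V - c" if x: "norm x \<le> 1" for x
  proof -
    let ?m = "\<lambda>A. indicator A x :: real"
    have "\<bar>J x (fst i)\<bar> powr p \<le> max 0 (S i ?m)" if i: "i \<in> I" for i
    proof -
      have "\<bar>ball_pairing (fst i) x\<bar> powr p \<le> norm (fst i) powr p"
        using abs_ball_pairing_le p by (intro powr_mono2) auto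
      also have "\<dots> < real (N (fst i) (snd i)) * snd i" using N[of "fst i" "snd i"] i by simp
      finally have "\<bar>ball_pairing (fst i) x\<bar> powr p \<le> S i ?m"
        unfolding S_def using \<delta>[of "fst i" "snd i"] i
        by (intro upper_sum_dirac[of _ "\<lambda>x. \<bar>ball_pairing (fst i) x\<bar> powr p"]) auto
      then show ?thesis using x by (simp add: ball_pairing_def)
    qed
    then have "(\<Sum>i\<in>I. w i * \<bar>J x (fst i)\<bar> powr p) \<le> (\<Sum>i\<in>I. w i * max 0 (S i ?m))"
      using w(2) by (intro sum_mono mult_left_mono) auto
    moreover have "c \<le> V - (\<Sum>i\<in>I. w i * max 0 (S i ?m))"
      using w(3)[OF T_I[OF charge_dirac[of x]]] by (simp add: V_def algebra_simps sum_subtractf)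
    ultimately show ?thesis by linarith
  qed
  have Vc: "0 \<le> V - c" using J_le[of 0] w(2) by (simp add: J_zero)
  obtain n :: nat and e where e: "bij_betw e {..<n} I" using ex_bij_betw_nat_finite[OF I] by (auto simp: atLeast0LessThan)
  \<comment> \<open>The p-th root of a weight becomes the weight itself once p-th powers are summed,
    and homogeneity carries it through \<open>f\<close>.\<close>
  define \<phi> where "\<phi> k = (w (e k) powr (1 / p)) *\<^sub>R predual_embedding (fst (e k))" for k
  have reindex: "(\<Sum>k<n. h (e k)) = sum h I" for h :: "'y \<times> real \<Rightarrow> real"
    by (rule sum.reindex_bij_betw[OF e])
  have "weak_norm p n \<phi> \<le> (V - c) powr (1 / p)"
  proof (rule weak_norm_le[OF p])
    fix x :: 'x assume x: "norm x \<le> 1"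
    have "(\<Sum>k<n. \<bar>\<phi> k x\<bar> powr p) = (\<Sum>k<n. w (e k) * \<bar>J x (fst (e k))\<bar> powr p)"
      using w(2) p by (simp add: \<phi>_def blinfun.scaleR_left abs_mult powr_mult powr_powr)
    also have "\<dots> \<le> V - c" unfolding reindex[of "\<lambda>i. w i * \<bar>J x (fst i)\<bar> powr p"] by (rule J_le[OF x])
    finally show "(\<Sum>k<n. \<bar>\<phi> k x\<bar> powr p) \<le> ((V - c) powr (1 / p)) powr p"
      using Vc p by (simp add: powr_powr)
  qed simp
  moreover have "(\<Sum>k<n. \<bar>f (\<phi> k)\<bar> powr p) powr (1 / p) \<le> 1 * weak_norm p n \<phi>"
    using bound unfolding p_bounded_by_def by blast
  moreover have "(\<Sum>k<n. \<bar>f (\<phi> k)\<bar> powr p) = V"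
  proof -
    have "(\<Sum>k<n. \<bar>f (\<phi> k)\<bar> powr p) = (\<Sum>k<n. w (e k) * v (e k))"
      using w(2) p nonneg by (simp add: \<phi>_def hom v_def abs_mult powr_mult powr_powr)
    then show ?thesis by (simp add: reindex[of "\<lambda>i. w i * v i"] V_def)
  qed
  ultimately have "V powr (1 / p) \<le> (V - c) powr (1 / p)" by simp
  then have "V \<le> V - c" using Vc w(1) p
    by (subst (asm) powr_inverse_le_iff) (auto simp: powr_powr)
  then show False using w(1) by simp
qed

text \<open>Every pair \<open>(y, \<delta>)\<close> imposes a closed condition on the charge,
  because upper sums are continuous in it; compactness then satisfies all of them at once.\<close>

lemma dominating_charge:
  assumes p: "1 \<le> p" and hom: "\<And>c \<phi>. 0 \<le> c \<Longrightarrow> f (c *\<^sub>R \<phi>) = c * f \<phi>"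
    and nonneg: "\<And>\<phi>. 0 \<le> f \<phi>" and bound: "p_bounded_by p 1 f"
  obtains m where "charge m" "\<And>y \<delta>. 0 < \<delta> \<Longrightarrow> \<exists>N.
    f (predual_embedding y) powr p \<le> upper_sum \<delta> N (\<lambda>x. \<bar>ball_pairing y x\<bar> powr p) m + \<delta>"
proof -
  \<comment> \<open>One more than the integer part: the bands are half-open, so they have to reach
    strictly beyond \<open>norm y powr p\<close>.\<close>
  define N where "N y \<delta> = nat \<lfloor>norm y powr p / \<delta>\<rfloor> + 1" for y :: 'y and \<delta> :: real
  have N: "norm y powr p < real (N y \<delta>) * \<delta>" if "0 < \<delta>" for y \<delta>
  proof -
    have "norm y powr p / \<delta> < real (N y \<delta>)" unfolding N_def using that by simp linarith
    then show ?thesis using that by (simp add: field_simps)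
  qed
  define C where "C = (\<lambda>(y, \<delta>). {m. f (predual_embedding y) powr p \<le>
    upper_sum \<delta> (N y \<delta>) (\<lambda>x. \<bar>ball_pairing y x\<bar> powr p) m + \<delta>})"
  have "{m. charge m} \<inter> (\<Inter>i\<in>UNIV \<times> {0<..}. C i) \<noteq> {}"
  proof (rule compact_imp_fip_image[OF compact_charges])
    show "closed (C i)" for i
      unfolding C_def upper_sum_def case_prod_unfold
      by (intro closed_Collect_le continuous_intros continuous_on_product_coordinates)
  next
    fix I :: "('y \<times> real) set" assume I: "finite I" "I \<subseteq> UNIV \<times> {0<..}"
    then have "\<exists>m. charge m \<and> (\<forall>(y, \<delta>)\<in>I. f (predual_embedding y) powr p \<le>
        upper_sum \<delta> (N y \<delta>) (\<lambda>x. \<bar>ball_pairing y x\<bar> powr p) m + \<delta>)"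
      by (intro dominating_charge_finite[OF p hom nonneg bound]) (auto intro: N)
    then show "{m. charge m} \<inter> (\<Inter>i\<in>I. C i) \<noteq> {}" by (fastforce simp: C_def)
  qed
  then obtain m where "charge m" "\<And>y \<delta>. 0 < \<delta> \<Longrightarrow> m \<in> C (y, \<delta>)" by fastforce
  then show thesis by (intro that[of m]) (auto simp: C_def)
qed

text \<open>The measure is moved from the Stone space to \<open>X\<close> along
  \<open>\<pi>\<close>, which sends an ultrafilter to a weak-star limit. Only measurability of the
  pairings survives the transport, and it is all that the weak-star integral requires.\<close>

lemma dominating_measure:
  assumes p: "1 \<le> p" and hom: "\<And>c \<phi>. 0 \<le> c \<Longrightarrow> f (c *\<^sub>R \<phi>) = c * f \<phi>"
    and nonneg: "\<And>\<phi>. 0 \<le> f \<phi>" and bound: "p_bounded_by p 1 f"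
  obtains M :: "'x measure" where "finite_measure M" "measure M (space M) = 1" "space M = cball 0 1"
    "\<And>y. (\<lambda>x. J x y) \<in> borel_measurable M"
    "\<And>y. f (predual_embedding y) powr p \<le> (\<integral>x. \<bar>J x y\<bar> powr p \<partial>M)"
proof -
  obtain m where m: "charge m" "\<And>y \<delta>. 0 < \<delta> \<Longrightarrow> \<exists>N.
      f (predual_embedding y) powr p \<le> upper_sum \<delta> N (\<lambda>x. \<bar>ball_pairing y x\<bar> powr p) m + \<delta>"
    using dominating_charge[OF p hom nonneg bound] by blast
  obtain P where P: "finite_measure P" "space P = stone_set UNIV"
      "\<And>A. stone_set A \<in> sets P" "\<And>A. measure P (stone_set A) = m A"
    using stone_measure[OF m(1)] by blast
  interpret P: finite_measure P by fact
  define \<pi> where "\<pi> u = (SOME x. norm x \<le> 1 \<and> (\<forall>y. (ball_pairing y \<longlongrightarrow> J x y) (ufilter u)))" for u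
  have \<pi>: "norm (\<pi> u) \<le> 1" "\<And>y. (ball_pairing y \<longlongrightarrow> J (\<pi> u) y) (ufilter u)"
    if "ultrafilter_charge u" for u
    using someI_ex[OF weak_star_limit[OF that]] by (auto simp: \<pi>_def)
  \<comment> \<open>Half-spaces given by the predual: they generate the least sigma-algebra making
    all pairings measurable. Preimages under \<open>\<pi>\<close> are superlevel sets of limits
    along ultrafilters, hence measurable.\<close>
  define G where "G = {{x \<in> cball 0 1. r < J x y} |r y. True}"
  define N where "N = sigma (cball 0 1) G"
  have N: "space N = cball 0 1" "sets N = sigma_sets (cball 0 1) G"
    unfolding N_def by (auto simp: G_def space_measure_of_conv intro!: sets_measure_of)
  have JN: "(\<lambda>x. J x y) \<in> borel_measurable N" for y
    unfolding borel_measurable_iff_greater using N by (auto simp: G_def)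
  have [measurable]: "(\<lambda>u. J (\<pi> u) y) \<in> borel_measurable P" for y
    by (rule stone_limit_measurable[OF P(2,3) \<pi>(2)])
  have \<pi>m: "\<pi> \<in> measurable P N"
    unfolding N_def
  proof (rule measurable_measure_of)
    show "G \<subseteq> Pow (cball 0 1)" by (auto simp: G_def)
    show "\<pi> \<in> space P \<rightarrow> cball 0 1" using \<pi>(1) by (auto simp: P stone_set_UNIV)
    fix A assume "A \<in> G"
    then obtain r y where A: "A = {x \<in> cball 0 1. r < J x y}" by (auto simp: G_def)
    have "\<pi> -` A \<inter> space P = {u \<in> space P. r < J (\<pi> u) y}"
      using \<pi>(1) by (auto simp: A P stone_set_UNIV)
    then show "\<pi> -` A \<inter> space P \<in> sets P" by simp
  qed
  define M where "M = distr P N \<pi>"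
  have M: "space M = cball 0 1" "sets M = sets N" by (auto simp: M_def N)
  show thesis
  proof (rule that[of M])
    show "finite_measure M" unfolding M_def by (rule P.finite_measure_distr[OF \<pi>m])
    have "measure M (space M) = measure P (stone_set UNIV)"
      using \<pi>m unfolding M_def by (subst measure_distr)
        (auto simp: P(2) simp flip: P(2) intro!: arg_cong[where f = "measure P"] dest: measurable_space)
    then show "measure M (space M) = 1" by (simp add: P(4) charge_UNIV[OF m(1)])
    show "space M = cball 0 1" by fact
    show Jm: "(\<lambda>x. J x y) \<in> borel_measurable M" for y using JN by (simp add: M_def)
    show "f (predual_embedding y) powr p \<le> (\<integral>x. \<bar>J x y\<bar> powr p \<partial>M)" for y
    proof (rule field_le_epsilon)
      fix \<delta> :: real assume \<delta>: "0 < \<delta>"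
      \<comment> \<open>One half of \<open>\<delta>\<close> is the slack in the choice of the
        charge, the other half is the band width lost on passing to the integral.\<close>
      obtain K where K: "f (predual_embedding y) powr p \<le>
          upper_sum (\<delta> / 2) K (\<lambda>x. \<bar>ball_pairing y x\<bar> powr p) m + \<delta> / 2"
        using m(2)[of "\<delta> / 2" y] \<delta> by auto
      also have "upper_sum (\<delta> / 2) K (\<lambda>x. \<bar>ball_pairing y x\<bar> powr p) m
          \<le> (\<integral>u. \<bar>J (\<pi> u) y\<bar> powr p \<partial>P) + \<delta> / 2"
      proof (rule upper_sum_le_integral[OF m(1) _ P, where R = "norm y powr p"])
        show "\<bar>ball_pairing y x\<bar> powr p \<le> norm y powr p" for x
          using abs_ball_pairing_le p by (intro powr_mono2) auto
        show "((\<lambda>x. \<bar>ball_pairing y x\<bar> powr p) \<longlongrightarrow> \<bar>J (\<pi> u) y\<bar> powr p) (ufilter u)"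
          if "ultrafilter_charge u" for u
          using p by (intro tendsto_powr' tendsto_rabs \<pi>(2)[OF that] tendsto_const) auto
      qed (use \<delta> in auto)
      also have "(\<integral>u. \<bar>J (\<pi> u) y\<bar> powr p \<partial>P) = (\<integral>x. \<bar>J x y\<bar> powr p \<partial>M)"
        unfolding M_def using JN by (intro integral_distr[symmetric] \<pi>m) measurable
      finally show "f (predual_embedding y) powr p \<le> (\<integral>x. \<bar>J x y\<bar> powr p \<partial>M) + \<delta>" by simp
    qed
  qed
qed

end

section \<open>Radon--Nikodym densities\<close>

text \<open>Strong measurability with convergence at every point of the space, not just almost
  everywhere: compositions with continuous functions are then measurable although \<open>M\<close>
  need not be complete.\<close>

definition simple_limit :: "'w measure \<Rightarrow> (nat \<Rightarrow> 'w \<Rightarrow> 'a::real_normed_vector) \<Rightarrow> ('w \<Rightarrow> 'a) \<Rightarrow> bool" where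
  "simple_limit M s h \<longleftrightarrow> (\<forall>i. simple_function M (s i)) \<and> (\<forall>w\<in>space M. (\<lambda>i. s i w) \<longlonglongrightarrow> h w)"

lemma simple_limit_const_seq:
  assumes "simple_function M h"
  shows "simple_limit M (\<lambda>_. h) h"
  using assms by (simp add: simple_limit_def)

lemma simple_limit_diff:
  assumes "simple_limit M s h" "simple_limit M s' h'"
  shows "simple_limit M (\<lambda>i w. s i w - s' i w) (\<lambda>w. h w - h' w)"
  using assms unfolding simple_limit_def
  by (auto intro!: tendsto_diff simple_function_compose2[where h = "(-)"])

lemma simple_limit_indicator:
  assumes "simple_limit M s h" "A \<in> sets M"
  shows "simple_limit M (\<lambda>i w. indicator A w *\<^sub>R s i w) (\<lambda>w. indicator A w *\<^sub>R h w)"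
  using assms unfolding simple_limit_def
  by (auto intro!: tendsto_intros simple_function_compose2[where h = "(*\<^sub>R)"])

lemma simple_limit_compose_measurable:
  fixes k :: "'a::real_normed_vector \<Rightarrow> real"
  assumes s: "simple_limit M s h" and k: "continuous_on UNIV k"
  shows "(\<lambda>w. k (h w)) \<in> borel_measurable M"
proof (rule borel_measurable_LIMSEQ_real)
  show "(\<lambda>i. k (s i w)) \<longlonglongrightarrow> k (h w)" if "w \<in> space M" for w
    using s that k by (intro continuous_on_tendsto_compose[OF k]) (auto simp: simple_limit_def)
  show "(\<lambda>w. k (s i w)) \<in> borel_measurable M" for i
    using s by (intro borel_measurable_simple_function simple_function_compose1[where g = k])
      (auto simp: simple_limit_def)
qed

text \<open>The integrand \<open>f\<close> is an almost everywhere limit of simple functions, and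
  composing it with \<open>\<psi>\<close> may fail to be measurable. So \<open>\<psi>\<close> is
  applied to an everywhere limit \<open>h\<close> agreeing with \<open>f\<close> almost everywhere,
  while the approximating simple functions remain those of \<open>f\<close>.\<close>

lemma has_bochner_integral_functional:
  fixes h :: "'w \<Rightarrow> 'a::banach" and \<psi> :: "'a \<Rightarrow> real"
  assumes int: "has_strong_bochner_integral M f I" and \<psi>: "bounded_linear \<psi>"
    and h: "simple_limit M r h" "AE w in M. f w = h w"
  shows "has_bochner_integral M (\<lambda>w. \<psi> (h w)) (\<psi> I)"
proof -
  interpret \<psi>: bounded_linear \<psi> by fact
  obtain s where s: "\<And>i. Bochner_Integration.simple_bochner_integrable M (s i)"
    "(\<lambda>i. \<integral>\<^sup>+w. ennreal (norm (f w - s i w)) \<partial>M) \<longlonglongrightarrow> 0"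
    "(\<lambda>i. Bochner_Integration.simple_bochner_integral M (s i)) \<longlonglongrightarrow> I"
    using int unfolding has_strong_bochner_integral_def by blast
  obtain K where K: "0 < K" "\<And>x. norm (\<psi> x) \<le> norm x * K" using \<psi>.pos_bounded by blast
  show ?thesis
  proof (rule has_bochner_integral.intros)
    show "(\<lambda>w. \<psi> (h w)) \<in> borel_measurable M"
      by (intro simple_limit_compose_measurable[OF h(1)] linear_continuous_on \<psi>)
    show "Bochner_Integration.simple_bochner_integrable M (\<lambda>w. \<psi> (s i w))" for i
      using simple_bochner_integrable_compose2[of "\<lambda>x _. \<psi> x", OF _ s(1) s(1)] by (simp add: \<psi>.zero)
    have "(\<lambda>i. \<psi> (Bochner_Integration.simple_bochner_integral M (s i))) \<longlonglongrightarrow> \<psi> I" by (rule \<psi>.tendsto[OF s(3)])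
    then show "(\<lambda>i. Bochner_Integration.simple_bochner_integral M (\<lambda>w. \<psi> (s i w))) \<longlonglongrightarrow> \<psi> I"
      by (simp add: simple_bochner_integral_linear[OF \<psi>.linear_axioms s(1)])
    have up: "(\<integral>\<^sup>+w. ennreal (norm (\<psi> (h w) - \<psi> (s i w))) \<partial>M) \<le>
        ennreal K * (\<integral>\<^sup>+w. ennreal (norm (f w - s i w)) \<partial>M)" for i
    proof -
      have "simple_limit M (\<lambda>_. s i) (s i)"
        using s(1) by (intro simple_limit_const_seq) (auto simp: simple_bochner_integrable.simps)
      then have [measurable]: "(\<lambda>w. norm (h w - s i w)) \<in> borel_measurable M"
        by (intro simple_limit_compose_measurable[OF simple_limit_diff[OF h(1)]] continuous_intros)
      have "(\<integral>\<^sup>+w. ennreal (norm (\<psi> (h w) - \<psi> (s i w))) \<partial>M) \<le>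
          (\<integral>\<^sup>+w. ennreal K * ennreal (norm (h w - s i w)) \<partial>M)"
        using K by (intro nn_integral_mono)
          (simp add: \<psi>.diff[symmetric] ennreal_mult'[symmetric] mult.commute ennreal_leI)
      also have "\<dots> = ennreal K * (\<integral>\<^sup>+w. ennreal (norm (h w - s i w)) \<partial>M)"
        by (intro nn_integral_cmult) measurable
      also have "(\<integral>\<^sup>+w. ennreal (norm (h w - s i w)) \<partial>M) = (\<integral>\<^sup>+w. ennreal (norm (f w - s i w)) \<partial>M)"
        using h(2) by (intro nn_integral_cong_AE) auto
      finally show ?thesis .
    qed
    have "(\<lambda>i. ennreal K * (\<integral>\<^sup>+w. ennreal (norm (f w - s i w)) \<partial>M)) \<longlonglongrightarrow> ennreal K * 0"
      by (rule ennreal_tendsto_cmult[OF _ s(2)]) simp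
    then have lim: "(\<lambda>i. ennreal K * (\<integral>\<^sup>+w. ennreal (norm (f w - s i w)) \<partial>M)) \<longlonglongrightarrow> 0" by simp
    show "(\<lambda>i. \<integral>\<^sup>+w. ennreal (norm (\<psi> (h w) - \<psi> (s i w))) \<partial>M) \<longlonglongrightarrow> 0"
      by (rule tendsto_sandwich[OF always_eventually always_eventually tendsto_const lim])
        (use up in simp_all)
  qed
qed

section \<open>The weak-star integral of the identity and its density\<close>

context dual_space
begin

context
  fixes M :: "'x measure"
  assumes fin: "finite_measure M" and space_M: "space M = cball 0 1"
    and J_measurable: "\<And>y. (\<lambda>x. J x y) \<in> borel_measurable M"
begin

interpretation finite_measure M by (rule fin)

lemma J_le_on_space: "x \<in> space M \<Longrightarrow> \<bar>J x y\<bar> \<le> norm y"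
  using abs_J_le[of x y] mult_right_mono[of "norm x" 1 "norm y"] by (auto simp: space_M)

lemma integrable_J: "integrable M (\<lambda>x. J x y)"
  using J_measurable J_le_on_space by (intro integrable_const_bound[where B = "norm y"]) auto

lemma integrable_indicator_J: "A \<in> sets M \<Longrightarrow> integrable M (\<lambda>x. indicator A x * J x y)"
  using integrable_mult_indicator[OF _ integrable_J[of y], of A] by simp

text \<open>The Gelfand integral over \<open>A\<close> of the identity map of the ball.\<close>

definition weak_integral :: "'x set \<Rightarrow> 'x" where
  "weak_integral A = inv J (Blinfun (\<lambda>y. \<integral>x. indicator A x * J x y \<partial>M))"

lemma abs_integral_indicator_J_le:
  assumes A: "A \<in> sets M"
  shows "\<bar>\<integral>x. indicator A x * J x y \<partial>M\<bar> \<le> norm y * measure M A"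
proof -
  have "\<bar>\<integral>x. indicator A x * J x y \<partial>M\<bar> \<le> (\<integral>x. \<bar>indicator A x * J x y\<bar> \<partial>M)"
    by (rule integral_abs_bound)
  also have "\<dots> \<le> (\<integral>x. norm y * indicator A x \<partial>M)"
  proof (rule integral_mono)
    show "\<bar>indicator A x * J x y\<bar> \<le> norm y * indicator A x" if "x \<in> space M" for x
      using J_le_on_space[OF that, of y] by (auto split: split_indicator)
  qed (use A integrable_indicator_J in \<open>auto simp: emeasure_eq_measure\<close>)
  also have "\<dots> = norm y * measure M A" using A by (simp add: sets.Int_space_eq2)
  finally show ?thesis .
qed

lemma J_weak_integral:
  assumes A: "A \<in> sets M"
  shows "J (weak_integral A) y = (\<integral>x. indicator A x * J x y \<partial>M)"
proof -
  have "bounded_linear (\<lambda>y. \<integral>x. indicator A x * J x y \<partial>M)"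
  proof (rule bounded_linear_intro)
    show "norm (\<integral>x. indicator A x * J x y \<partial>M) \<le> norm y * measure M A" for y
      using abs_integral_indicator_J_le[OF A] by simp
  qed (use integrable_indicator_J[OF A] in
      \<open>simp_all add: blinfun.add_right blinfun.scaleR_right algebra_simps Bochner_Integration.integral_add\<close>)
  then show ?thesis
    using surj_f_inv_f[OF surj_J] by (simp add: weak_integral_def bounded_linear_Blinfun_apply)
qed

text \<open>The estimate behind all hypotheses of the Radon--Nikodym property: domination by a
  finite measure gives countable additivity, bounded variation and vanishing on null sets.\<close>

lemma norm_weak_integral_le:
  assumes A: "A \<in> sets M"
  shows "norm (weak_integral A) \<le> measure M A"
proof -
  have "norm (J (weak_integral A)) \<le> measure M A"
    using abs_integral_indicator_J_le[OF A]
    by (intro norm_blinfun_bound) (auto simp: J_weak_integral[OF A] mult.commute)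
  then show ?thesis by (simp add: norm_J)
qed

lemma weak_integral_Un:
  assumes A: "A \<in> sets M" and B: "B \<in> sets M" and AB: "A \<inter> B = {}"
  shows "weak_integral (A \<union> B) = weak_integral A + weak_integral B"
proof (rule inj_J, rule blinfun_eqI)
  fix y
  have "J (weak_integral (A \<union> B)) y = (\<integral>x. indicator (A \<union> B) x * J x y \<partial>M)"
    using A B by (intro J_weak_integral) auto
  also have "\<dots> = (\<integral>x. indicator A x * J x y + indicator B x * J x y \<partial>M)"
    using AB by (intro Bochner_Integration.integral_cong) (auto split: split_indicator)
  also have "\<dots> = (\<integral>x. indicator A x * J x y \<partial>M) + (\<integral>x. indicator B x * J x y \<partial>M)"
    by (intro Bochner_Integration.integral_add integrable_indicator_J A B)
  finally show "J (weak_integral (A \<union> B)) y = J (weak_integral A + weak_integral B) y"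
    by (simp add: J_weak_integral A B J_add blinfun.add_left)
qed

lemma vector_measure_weak_integral: "vector_measure M weak_integral"
  unfolding vector_measure_def
proof (intro allI impI)
  fix A :: "nat \<Rightarrow> 'x set" assume A: "range A \<subseteq> sets M" "disjoint_family A"
  have Ai: "A i \<in> sets M" for i using A(1) by auto
  define U where "U n = (\<Union>i<n. A i)" for n
  have U: "U n \<in> sets M" for n using Ai by (auto simp: U_def)
  have "weak_integral {} = 0"
    using norm_weak_integral_le[of "{}"] by simp
  have disj: "U n \<inter> A n = {}" for n
  proof -
    have "A i \<inter> A n = {}" if "i < n" for i
      using disjoint_family_onD[OF A(2), of i n] that by simp
    then show ?thesis unfolding U_def by blast
  qed
  have sumF: "(\<Sum>i<n. weak_integral (A i)) = weak_integral (U n)" for n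
  proof (induction n)
    case 0
    show ?case using \<open>weak_integral {} = 0\<close> by (simp add: U_def)
  next
    case (Suc n)
    have "U (Suc n) = U n \<union> A n" by (auto simp: U_def less_Suc_eq)
    then show ?case using Suc weak_integral_Un[OF U Ai disj] by simp
  qed
  have sumM: "(\<Sum>i<n. measure M (A i)) = measure M (U n)" for n
  proof (induction n)
    case 0
    show ?case by (simp add: U_def)
  next
    case (Suc n)
    have "U (Suc n) = U n \<union> A n" by (auto simp: U_def less_Suc_eq)
    then show ?case using Suc finite_measure_Union[OF U Ai disj] by simp
  qed
  let ?V = "\<Union>i. A i"
  have V: "?V \<in> sets M" using Ai by auto
  \<comment> \<open>The remainder of the series is the integral over the part of the union not yet
    exhausted, whose measure tends to zero.\<close>
  have bound: "norm ((\<Sum>i<n. weak_integral (A i)) - weak_integral ?V) \<le>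
      measure M ?V - (\<Sum>i<n. measure M (A i))" for n
  proof -
    have sub: "U n \<subseteq> ?V" by (auto simp: U_def)
    then have "weak_integral ?V = weak_integral (U n) + weak_integral (?V - U n)"
      using weak_integral_Un[OF U[of n], of "?V - U n"] U V by (simp add: Un_absorb1)
    then have "norm ((\<Sum>i<n. weak_integral (A i)) - weak_integral ?V) = norm (weak_integral (?V - U n))"
      by (simp add: sumF)
    also have "\<dots> \<le> measure M (?V - U n)" using U V by (intro norm_weak_integral_le) auto
    also have "\<dots> = measure M ?V - measure M (U n)" using sub U V by (intro finite_measure_Diff)
    finally show ?thesis by (simp add: sumM)
  qed
  have "(\<lambda>n. measure M ?V - (\<Sum>i<n. measure M (A i))) \<longlonglongrightarrow> measure M ?V - measure M ?V"
    using finite_measure_UNION[OF A] by (intro tendsto_intros) (simp add: sums_def)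
  then have "(\<lambda>n. measure M ?V - (\<Sum>i<n. measure M (A i))) \<longlonglongrightarrow> 0"
    by (simp only: diff_self)
  then have "(\<lambda>n. (\<Sum>i<n. weak_integral (A i)) - weak_integral ?V) \<longlonglongrightarrow> 0"
    by (rule Lim_null_comparison[rotated]) (use bound in \<open>intro always_eventually allI\<close>)
  then show "(\<lambda>i. weak_integral (A i)) sums weak_integral ?V"
    unfolding sums_def by (rule LIM_zero_cancel)
qed

lemma bounded_variation_weak_integral: "bounded_variation M weak_integral"
  unfolding bounded_variation_def
proof (intro exI allI impI)
  fix P assume P: "finite P" "P \<subseteq> sets M" "disjoint P"
  have "(\<Sum>A\<in>P. norm (weak_integral A)) \<le> (\<Sum>A\<in>P. measure M A)"
    using P by (intro sum_mono norm_weak_integral_le) auto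
  also have "\<dots> = measure M (\<Union>A\<in>P. A)"
    using P by (intro finite_measure_finite_Union[symmetric])
      (auto simp: disjoint_family_on_def disjoint_def)
  also have "\<dots> \<le> measure M (space M)" by (rule bounded_measure)
  finally show "(\<Sum>A\<in>P. norm (weak_integral A)) \<le> measure M (space M)" .
qed

lemma weak_integral_null:
  assumes "A \<in> null_sets M"
  shows "weak_integral A = 0"
  using norm_weak_integral_le[of A] assms by (simp add: null_sets_def measure_def)

text \<open>Paired with a fixed \<open>y\<close>, the density and the identity have the same
  integral over every measurable set, so they agree almost everywhere. The exceptional set depends
  on \<open>y\<close>.\<close>

lemma strong_density_exists:
  assumes RNP: "radon_nikodym_property TYPE('x)"
  obtains h s where "simple_limit M s h" "\<And>y. AE w in M. J (h w) y = J w y"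
proof -
  have "radon_nikodym_wrt M TYPE('x)" using RNP fin by (simp add: radon_nikodym_property_def)
  then obtain g where g: "\<And>A. A \<in> sets M \<Longrightarrow>
      has_strong_bochner_integral M (\<lambda>w. indicator A w *\<^sub>R g w) (weak_integral A)"
    unfolding radon_nikodym_wrt_def
    using vector_measure_weak_integral bounded_variation_weak_integral weak_integral_null by blast
  obtain s where s: "\<And>i. Bochner_Integration.simple_bochner_integrable M (s i)"
    "AE w in M. (\<lambda>i. s i w) \<longlonglongrightarrow> indicator (space M) w *\<^sub>R g w"
    using g[OF sets.top] unfolding has_strong_bochner_integral_def by blast
  obtain Z where Z: "Z \<in> null_sets M" "\<And>w. w \<in> space M \<Longrightarrow> w \<notin> Z \<Longrightarrow> (\<lambda>i. s i w) \<longlonglongrightarrow> g w"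
    using s(2) by (auto elim!: AE_E3 simp: indicator_def)
  define C where "C = space M - Z"
  have C: "C \<in> sets M" using Z by (auto simp: C_def)
  \<comment> \<open>Changing the density to \<open>0\<close> outside \<open>C\<close>, and cutting
    the simple functions to \<open>C\<close>, makes the convergence hold at every point.\<close>
  define h where "h w = (if w \<in> C then g w else 0)" for w
  have lim: "simple_limit M (\<lambda>i w. indicator C w *\<^sub>R s i w) h"
    unfolding simple_limit_def
  proof (intro conjI allI ballI)
    have "simple_function M (s i)" for i using s(1) by (simp add: simple_bochner_integrable.simps)
    then show "simple_function M (\<lambda>w. indicator C w *\<^sub>R s i w)" for i
      using C by (intro simple_function_compose2[where h = "(*\<^sub>R)"]) auto
    show "(\<lambda>i. indicator C w *\<^sub>R s i w) \<longlonglongrightarrow> h w" if "w \<in> space M" for w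
      using Z(2)[of w] by (auto simp: h_def C_def)
  qed
  have ae: "AE w in M. g w = h w"
    using AE_not_in[OF Z(1)] by (auto simp: h_def C_def elim!: eventually_mono)
  have int: "has_bochner_integral M (\<lambda>w. J (indicator A w *\<^sub>R h w) y) (J (weak_integral A) y)"
    if A: "A \<in> sets M" for A y
  proof (rule has_bochner_integral_functional[OF g[OF A] _ simple_limit_indicator[OF lim A]])
    have "bounded_linear (blinfun_apply (predual_embedding y))" by (rule blinfun.bounded_linear_right)
    then show "bounded_linear (\<lambda>x. J x y)" by (simp only: predual_embedding_apply[abs_def])
    show "AE w in M. indicator A w *\<^sub>R g w = indicator A w *\<^sub>R h w" using ae by auto
  qed
  show thesis
  proof (rule that[OF lim])
    fix y
    have "integrable M (\<lambda>w. J (indicator (space M) w *\<^sub>R h w) y)"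
      using int[OF sets.top] by (rule integrable.intros)
    then have inth: "integrable M (\<lambda>w. J (h w) y)"
      by (rule Bochner_Integration.integrable_cong[THEN iffD1, rotated -1]) auto
    show "AE w in M. J (h w) y = J w y"
    proof (rule density_unique_real[OF inth integrable_J])
      fix A assume A: "A \<in> sets M"
      have "(\<integral>w\<in>A. J (h w) y \<partial>M) = (\<integral>w. J (indicator A w *\<^sub>R h w) y \<partial>M)"
        by (simp add: set_lebesgue_integral_def J_scaleR blinfun.scaleR_left)
      also have "\<dots> = J (weak_integral A) y"
        using int[OF A] by (rule has_bochner_integral_integral_eq)
      also have "\<dots> = (\<integral>w\<in>A. J w y \<partial>M)"
        by (simp add: J_weak_integral[OF A] set_lebesgue_integral_def)
      finally show "(\<integral>w\<in>A. J (h w) y \<partial>M) = (\<integral>w\<in>A. J w y \<partial>M)" .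
    qed
  qed
qed

text \<open>The density takes almost all its values in a separable space, which is normed by countably
  many elements of the predual.\<close>

lemma strong_density_bounded:
  assumes lim: "simple_limit M s h" and eq: "\<And>y. AE w in M. J (h w) y = J w y"
  shows "AE w in M. norm (h w) \<le> 1"
proof -
  define D where "D = (\<Union>i. s i ` space M)"
  have "countable D"
    unfolding D_def using lim by (auto simp: simple_limit_def simple_function_def intro: countable_finite)
  have "\<exists>y. norm y \<le> 1 \<and> norm d - inverse (real (Suc k)) \<le> J d y" for d k
    using norming[of "inverse (real (Suc k))" d] by (metis inverse_positive_iff_positive of_nat_0_less_iff zero_less_Suc)
  then obtain Y where Y: "\<And>d k. norm (Y d k) \<le> 1" "\<And>d k. norm d - inverse (real (Suc k)) \<le> J d (Y d k)"
    by metis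
  have "AE w in M. \<forall>(d, k)\<in>D \<times> UNIV. J (h w) (Y d k) = J w (Y d k)"
    using eq \<open>countable D\<close> by (subst AE_ball_countable) auto
  with AE_space show ?thesis
  proof eventually_elim
    case (elim w)
    \<comment> \<open>The norming element is chosen for \<open>s i w\<close>, which ranges over a
      countable set, and not for \<open>h w\<close>; the discrepancy is absorbed in
      \<open>norm (s i w - h w)\<close>.\<close>
    have le: "norm (s i w) \<le> 1 + norm (s i w - h w)" for i
    proof (rule field_le_epsilon)
      fix e :: real assume "0 < e"
      then obtain k where k: "inverse (real (Suc k)) < e" using reals_Archimedean by blast
      let ?y = "Y (s i w) k"
      have "s i w \<in> D" using elim by (auto simp: D_def)
      then have "J (h w) ?y = J w ?y" using elim by blast
      then have "J (s i w) ?y = J (s i w - h w) ?y + J w ?y" by (simp add: J_diff blinfun.diff_left)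
      also have "J (s i w - h w) ?y \<le> norm (s i w - h w) * norm ?y"
        using abs_J_le[of "s i w - h w" ?y] by simp
      also have "\<dots> \<le> norm (s i w - h w)" using Y(1) by (simp add: mult_left_le)
      also have "J w ?y \<le> 1" using J_le_on_space[of w ?y] elim Y(1)[of "s i w" k] by linarith
      finally show "norm (s i w) \<le> 1 + norm (s i w - h w) + e" using Y(2)[of "s i w" k] k by simp
    qed
    have conv: "(\<lambda>i. s i w) \<longlonglongrightarrow> h w" using lim elim by (auto simp: simple_limit_def)
    have "(\<lambda>i. 1 + norm (s i w - h w)) \<longlonglongrightarrow> 1 + norm (h w - h w)"
      by (intro tendsto_intros conv)
    then have "(\<lambda>i. 1 + norm (s i w - h w)) \<longlonglongrightarrow> 1" by simp
    then show "norm (h w) \<le> 1"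
      by (rule LIMSEQ_le[OF tendsto_norm[OF conv]]) (use le in auto)
  qed
qed

lemma bounded_strong_density:
  assumes RNP: "radon_nikodym_property TYPE('x)"
  obtains h s where "simple_limit M s h" "\<And>i w. norm (s i w) \<le> 2" "\<And>w. norm (h w) \<le> 1"
    "\<And>y. AE w in M. J (h w) y = J w y"
proof -
  obtain h s where hs: "simple_limit M s h" "\<And>y. AE w in M. J (h w) y = J w y"
    using strong_density_exists[OF RNP] by blast
  obtain Z where Z: "Z \<in> null_sets M" "\<And>w. w \<in> space M \<Longrightarrow> w \<notin> Z \<Longrightarrow> norm (h w) \<le> 1"
    using strong_density_bounded[OF hs] by (auto elim!: AE_E3)
  define C where "C = space M - Z"
  have C: "C \<in> sets M" using Z by (auto simp: C_def)
  define h' where "h' w = (if w \<in> C then h w else 0)" for w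
  \<comment> \<open>Since the limit has norm at most \<open>1\<close> on \<open>C\<close>,
    truncation at \<open>2\<close> eventually changes nothing at any given point, yet it supplies
    the uniform bound for dominated convergence.\<close>
  define s' where "s' i w = indicator C w *\<^sub>R (if norm (s i w) \<le> 2 then s i w else 0)" for i w
  show thesis
  proof (rule that[of s' h'])
    show "norm (s' i w) \<le> 2" for i w by (auto simp: s'_def indicator_def)
    show "norm (h' w) \<le> 1" for w using Z(2) by (auto simp: h'_def C_def)
    show "AE w in M. J (h' w) y = J w y" for y
      using hs(2)[of y] AE_not_in[OF Z(1)] AE_space by eventually_elim (simp add: h'_def C_def)
    show "simple_limit M s' h'"
      unfolding simple_limit_def
    proof (intro conjI allI ballI)
      have "simple_function M (\<lambda>w. if norm (s i w) \<le> 2 then s i w else 0)" for i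
        using hs(1) simple_function_compose1[of M "s i" "\<lambda>x. if norm x \<le> 2 then x else 0"]
        by (simp add: simple_limit_def)
      then show "simple_function M (s' i)" for i
        unfolding s'_def using C by (intro simple_function_compose2[where h = "(*\<^sub>R)"]) auto
      fix w assume w: "w \<in> space M"
      show "(\<lambda>i. s' i w) \<longlonglongrightarrow> h' w"
      proof (cases "w \<in> C")
        case True
        have conv: "(\<lambda>i. s i w) \<longlonglongrightarrow> h w" using hs(1) w by (simp add: simple_limit_def)
        have "norm (h w) < 2" using Z(2)[OF w] True by (auto simp: C_def)
        then have "\<forall>\<^sub>F i in sequentially. norm (s i w) < 2"
          by (rule order_tendstoD(2)[OF tendsto_norm[OF conv]])
        then have "\<forall>\<^sub>F i in sequentially. s i w = s' i w"
          by eventually_elim (use True in \<open>simp add: s'_def\<close>)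
        then have "(\<lambda>i. s' i w) \<longlonglongrightarrow> h w" using conv by (rule Lim_transform_eventually[rotated])
        then show ?thesis using True by (simp add: h'_def)
      qed (simp add: s'_def h'_def)
    qed
  qed
qed

end

end

section \<open>Majorants in the free lattice\<close>

definition lp_functional :: "'w measure \<Rightarrow> real \<Rightarrow> ('w \<Rightarrow> 'a::banach) \<Rightarrow> ('a \<Rightarrow>\<^sub>L real) \<Rightarrow> real" where
  "lp_functional M p h \<psi> = (\<integral>w. \<bar>\<psi> (h w)\<bar> powr p \<partial>M) powr (1 / p)"

context finite_measure
begin

lemma integrable_apply_powr:
  fixes h :: "'a \<Rightarrow> 'b::banach" and p :: real
  assumes p: "1 \<le> p" and lim: "simple_limit M s h" and R: "\<And>w. norm (h w) \<le> R"
  shows "integrable M (\<lambda>w. \<bar>blinfun_apply \<psi> (h w)\<bar> powr p)"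
proof (rule integrable_const_bound[where B = "(norm \<psi> * R) powr p"])
  have "continuous_on UNIV (\<lambda>x. \<bar>blinfun_apply \<psi> x\<bar> powr p)"
    using p by (intro continuous_on_powr' continuous_intros blinfun.continuous_on) auto
  then show "(\<lambda>w. \<bar>blinfun_apply \<psi> (h w)\<bar> powr p) \<in> borel_measurable M"
    by (rule simple_limit_compose_measurable[OF lim])
  have "\<bar>blinfun_apply \<psi> (h w)\<bar> \<le> norm \<psi> * R" for w
    using norm_blinfun[of \<psi> "h w"] mult_left_mono[OF R[of w], of "norm \<psi>"] by simp
  then show "AE w in M. norm (\<bar>blinfun_apply \<psi> (h w)\<bar> powr p) \<le> (norm \<psi> * R) powr p"
    using p by (intro AE_I2) (simp add: powr_mono2)
qed

lemma integrable_norm_powr: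
  fixes h :: "'a \<Rightarrow> 'b::banach" and p :: real
  assumes p: "1 \<le> p" and lim: "simple_limit M s h" and R: "\<And>w. norm (h w) \<le> R"
  shows "integrable M (\<lambda>w. norm (h w) powr p)"
proof (rule integrable_const_bound[where B = "R powr p"])
  have "continuous_on UNIV (\<lambda>x :: 'b. norm x powr p)"
    using p by (intro continuous_on_powr' continuous_intros) auto
  then show "(\<lambda>w. norm (h w) powr p) \<in> borel_measurable M"
    by (rule simple_limit_compose_measurable[OF lim])
  show "AE w in M. norm (norm (h w) powr p) \<le> R powr p"
    using p R by (intro AE_I2) (simp add: powr_mono2)
qed

text \<open>Sum and integral are exchanged, and the weak p-norm estimate is applied at each point
  \<open>h w\<close>. The constant is the \<open>L_p\<close>-norm of \<open>h\<close>, so small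
  \<open>h\<close> gives small p-norm; this is what makes approximation by simple functions
  work.\<close>

lemma p_bounded_by_lp_functional:
  fixes h :: "'a \<Rightarrow> 'b::banach"
  assumes p: "1 \<le> p" and lim: "simple_limit M s h" and R: "\<And>w. norm (h w) \<le> R"
  shows "p_bounded_by p ((\<integral>w. norm (h w) powr p \<partial>M) powr (1 / p)) (lp_functional M p h)"
  unfolding p_bounded_by_def
proof (intro allI)
  fix n and \<psi> :: "nat \<Rightarrow> 'b \<Rightarrow>\<^sub>L real"
  let ?W = "weak_norm p n \<psi>" and ?I = "\<integral>w. norm (h w) powr p \<partial>M"
  have W: "0 \<le> ?W" by (rule weak_norm_nonneg[OF p])
  note int = integrable_apply_powr[OF p lim R]
  have "(\<Sum>i<n. \<bar>lp_functional M p h (\<psi> i)\<bar> powr p) = (\<Sum>i<n. \<integral>w. \<bar>\<psi> i (h w)\<bar> powr p \<partial>M)"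
    using p by (simp add: lp_functional_def powr_powr)
  also have "\<dots> = (\<integral>w. (\<Sum>i<n. \<bar>\<psi> i (h w)\<bar> powr p) \<partial>M)"
    by (rule Bochner_Integration.integral_sum[symmetric]) (rule int)
  also have "\<dots> \<le> (\<integral>w. ?W powr p * norm (h w) powr p \<partial>M)"
  proof (rule integral_mono)
    show "integrable M (\<lambda>w. \<Sum>i<n. \<bar>\<psi> i (h w)\<bar> powr p)"
      by (rule Bochner_Integration.integrable_sum) (rule int)
    show "integrable M (\<lambda>w. ?W powr p * norm (h w) powr p)"
      by (intro integrable_mult_right integrable_norm_powr[OF p lim R])
  qed (rule sum_powr_apply_le_weak_norm[OF p])
  also have "\<dots> = ?W powr p * ?I" by simp
  finally have "(\<Sum>i<n. \<bar>lp_functional M p h (\<psi> i)\<bar> powr p) powr (1 / p) \<le> (?W powr p * ?I) powr (1 / p)"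
    using p by (intro powr_mono2) (auto simp: sum_nonneg)
  also have "\<dots> = ?I powr (1 / p) * ?W"
    using p W by (simp add: powr_mult powr_powr)
  finally show "(\<Sum>i<n. \<bar>lp_functional M p h (\<psi> i)\<bar> powr p) powr (1 / p) \<le> ?I powr (1 / p) * ?W" .
qed

lemma lp_functional_diff_le:
  fixes h h' :: "'a \<Rightarrow> 'b::banach"
  assumes p: "1 \<le> p" and lim: "simple_limit M s h" "simple_limit M s' h'"
    and R: "\<And>w. norm (h w) \<le> R" "\<And>w. norm (h' w) \<le> R'"
  shows "\<bar>lp_functional M p h \<psi> - lp_functional M p h' \<psi>\<bar> \<le> lp_functional M p (\<lambda>w. h w - h' w) \<psi>"
proof -
  have Rd: "norm (h w - h' w) \<le> R + R'" for w
    using norm_triangle_ineq4[of "h w" "h' w"] R(1)[of w] R(2)[of w] by linarith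
  note int = integrable_apply_powr[OF p lim(1) R(1), of \<psi>] integrable_apply_powr[OF p lim(2) R(2), of \<psi>]
    integrable_apply_powr[OF p simple_limit_diff[OF lim] Rd, of \<psi>]
  have eq: "\<psi> (h' w) + \<psi> (h w - h' w) = \<psi> (h w)" "\<psi> (h w) + (- \<psi> (h w - h' w)) = \<psi> (h' w)" for w
    by (simp_all add: blinfun.diff_right)
  have "lp_functional M p h \<psi> \<le> lp_functional M p h' \<psi> + lp_functional M p (\<lambda>w. h w - h' w) \<psi>"
    using integral_powr_triangle[OF p, of M "\<lambda>w. \<psi> (h' w)" "\<lambda>w. \<psi> (h w - h' w)"] int
    unfolding lp_functional_def eq by simp
  moreover have "lp_functional M p h' \<psi> \<le> lp_functional M p h \<psi> + lp_functional M p (\<lambda>w. h w - h' w) \<psi>"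
    using integral_powr_triangle[OF p, of M "\<lambda>w. \<psi> (h w)" "\<lambda>w. - \<psi> (h w - h' w)"] int
    unfolding lp_functional_def eq abs_minus_cancel by simp
  ultimately show ?thesis by linarith
qed

lemma lp_functional_simple:
  fixes h :: "'a \<Rightarrow> 'b::banach"
  assumes p: "1 \<le> p" and h: "simple_function M h"
  obtains m :: nat and x where
    "\<And>\<psi>. lp_functional M p h \<psi> = (\<Sum>j<m. \<bar>blinfun_apply \<psi> (x j)\<bar> powr p) powr (1 / p)"
proof -
  define S where "S d = h -` {d} \<inter> space M" for d
  have fin: "finite (h ` space M)" and S: "\<And>d. d \<in> h ` space M \<Longrightarrow> S d \<in> sets M"
    using h by (auto simp: simple_function_def S_def)
  obtain e and m :: nat where e: "bij_betw e {..<m} (h ` space M)"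
    using ex_bij_betw_nat_finite[OF fin] by (auto simp: atLeast0LessThan)
  \<comment> \<open>Each value of \<open>h\<close> absorbs the p-th root of the measure of its level
    set, which turns the integral into an unweighted p-sum.\<close>
  define x where "x j = (measure M (S (e j)) powr (1 / p)) *\<^sub>R e j" for j
  have "lp_functional M p h \<psi> = (\<Sum>j<m. \<bar>blinfun_apply \<psi> (x j)\<bar> powr p) powr (1 / p)" for \<psi>
  proof -
    have "(\<integral>w. \<bar>\<psi> (h w)\<bar> powr p \<partial>M) = (\<integral>w. (\<Sum>d\<in>h ` space M. \<bar>\<psi> d\<bar> powr p * indicator (S d) w) \<partial>M)"
    proof (rule Bochner_Integration.integral_cong[OF refl])
      fix w assume w: "w \<in> space M"
      have "(\<Sum>d\<in>h ` space M. \<bar>\<psi> d\<bar> powr p * indicator (S d) w) =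
          (\<Sum>d\<in>h ` space M. if h w = d then \<bar>\<psi> d\<bar> powr p else 0)"
        using w by (intro sum.cong refl) (auto simp: S_def)
      also have "\<dots> = \<bar>\<psi> (h w)\<bar> powr p" using fin w by simp
      finally show "\<bar>\<psi> (h w)\<bar> powr p = (\<Sum>d\<in>h ` space M. \<bar>\<psi> d\<bar> powr p * indicator (S d) w)" by simp
    qed
    also have "\<dots> = (\<Sum>d\<in>h ` space M. \<integral>w. \<bar>\<psi> d\<bar> powr p * indicator (S d) w \<partial>M)"
    proof (rule Bochner_Integration.integral_sum)
      fix d assume "d \<in> h ` space M"
      then have "integrable M (indicat_real (S d))"
        using S by (intro integrable_real_indicator) (auto simp: emeasure_eq_measure)
      then show "integrable M (\<lambda>w. \<bar>\<psi> d\<bar> powr p * indicator (S d) w)"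
        by (rule integrable_mult_right)
    qed
    also have "\<dots> = (\<Sum>d\<in>h ` space M. \<bar>\<psi> d\<bar> powr p * measure M (S d))"
      using S by (intro sum.cong refl) (simp add: sets.Int_space_eq2)
    also have "\<dots> = (\<Sum>j<m. \<bar>\<psi> (e j)\<bar> powr p * measure M (S (e j)))"
      by (rule sum.reindex_bij_betw[OF e, symmetric])
    also have "\<dots> = (\<Sum>j<m. \<bar>\<psi> (x j)\<bar> powr p)"
      using p by (simp add: x_def blinfun.scaleR_right abs_mult powr_mult powr_powr mult.commute)
    finally show ?thesis by (simp add: lp_functional_def)
  qed
  then show thesis by (rule that)
qed

lemma lp_functional_in_FBL:
  fixes h :: "'a \<Rightarrow> 'b::banach"
  assumes p: "1 \<le> p" and lim: "simple_limit M s h"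
    and R: "\<And>w. norm (h w) \<le> R" "\<And>i w. norm (s i w) \<le> R'"
  shows "lp_functional M p h \<in> FBL p"
proof (rule FBL_I[OF p powr_ge_zero _ p_bounded_by_lp_functional[OF p lim R(1)]])
  show "lp_functional M p h (c *\<^sub>R \<psi>) = c * lp_functional M p h \<psi>" if "0 \<le> c" for c \<psi>
    using that p by (simp add: lp_functional_def blinfun.scaleR_left abs_mult powr_mult powr_powr)
next
  fix e :: real assume e: "0 < e"
  have simple: "simple_function M (s i)" for i using lim by (simp add: simple_limit_def)
  note lim_s = simple_limit_const_seq[OF simple]
  have Rd: "norm (h w - s i w) \<le> R + R'" for i w
    using norm_triangle_ineq4[of "h w" "s i w"] R(1)[of w] R(2)[of i w] by linarith
  \<comment> \<open>This \<open>L_p\<close>-distance bounds the p-norm of the difference of the two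
    functionals. It tends to zero by dominated convergence, a constant being integrable for a finite
    measure.\<close>
  define \<epsilon> where "\<epsilon> i = (\<integral>w. norm (h w - s i w) powr p \<partial>M) powr (1 / p)" for i
  have "(\<lambda>i. \<integral>w. norm (h w - s i w) powr p \<partial>M) \<longlonglongrightarrow> (\<integral>w. 0 \<partial>M)"
  proof (rule integral_dominated_convergence[where w = "\<lambda>_. (R + R') powr p"])
    show "(\<lambda>w. norm (h w - s i w) powr p) \<in> borel_measurable M" for i
      by (rule borel_measurable_integrable[OF integrable_norm_powr[OF p simple_limit_diff[OF lim lim_s] Rd]])
    show "AE w in M. norm (norm (h w - s i w) powr p) \<le> (R + R') powr p" for i
      using p Rd by (intro AE_I2) (simp add: powr_mono2)
    show "AE w in M. (\<lambda>i. norm (h w - s i w) powr p) \<longlonglongrightarrow> 0"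
    proof (rule AE_I2)
      fix w assume "w \<in> space M"
      then have "(\<lambda>i. s i w) \<longlonglongrightarrow> h w" using lim by (simp add: simple_limit_def)
      then have "(\<lambda>i. norm (h w - s i w)) \<longlonglongrightarrow> norm (h w - h w)" by (intro tendsto_intros)
      then have "(\<lambda>i. norm (h w - s i w) powr p) \<longlonglongrightarrow> norm (h w - h w) powr p"
        by (rule tendsto_powr'[OF _ tendsto_const]) (use p in auto)
      then show "(\<lambda>i. norm (h w - s i w) powr p) \<longlonglongrightarrow> 0" by simp
    qed
  qed simp_all
  then have "(\<lambda>i. \<integral>w. norm (h w - s i w) powr p \<partial>M) \<longlonglongrightarrow> 0" by simp
  then have "\<epsilon> \<longlonglongrightarrow> 0 powr (1 / p)"
    unfolding \<epsilon>_def by (rule tendsto_powr'[OF _ tendsto_const]) (use p in auto)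
  then have "\<forall>\<^sub>F i in sequentially. \<epsilon> i < e / 2" using e by (intro order_tendstoD(2)) auto
  then obtain i where i: "\<epsilon> i < e / 2" by (metis eventually_False_sequentially eventually_mono)
  obtain m :: nat and x where x: "\<And>\<psi>. lp_functional M p (s i) \<psi> = (\<Sum>j<m. \<bar>blinfun_apply \<psi> (x j)\<bar> powr p) powr (1 / p)"
    by (rule lp_functional_simple[OF p simple[of i]]) blast
  obtain k where k: "k \<in> FVL" "p_bounded_by p (e / 2) (\<lambda>\<psi>. lp_functional M p (s i) \<psi> - k \<psi>)"
    using FVL_approximates_lp_sum[OF p half_gt_zero[OF e], where m = m and x = x] unfolding x by blast
  have "p_bounded_by p (e / 2) (\<lambda>\<psi>. lp_functional M p h \<psi> - lp_functional M p (s i) \<psi>)"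
  proof (rule p_bounded_by_mono[OF p p_bounded_by_lp_functional[OF p simple_limit_diff[OF lim lim_s] Rd]])
    show "\<bar>lp_functional M p h \<psi> - lp_functional M p (s i) \<psi>\<bar> \<le>
        \<bar>lp_functional M p (\<lambda>w. h w - s i w) \<psi>\<bar>" for \<psi>
      by (rule order_trans[OF lp_functional_diff_le[OF p lim lim_s R] abs_ge_self])
    show "(\<integral>w. norm (h w - s i w) powr p \<partial>M) powr (1 / p) \<le> e / 2" using i by (simp add: \<epsilon>_def)
  qed
  from p_bounded_by_add[OF p this k(2)] have "p_bounded_by p e (\<lambda>\<psi>. lp_functional M p h \<psi> - k \<psi>)" by simp
  with k(1) show "\<exists>k\<in>FVL. p_bounded_by p e (\<lambda>\<psi>. lp_functional M p h \<psi> - k \<psi>)" by blast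
qed

end

lemma (in dual_space) FBL_majorant:
  fixes f :: "('x \<Rightarrow>\<^sub>L real) \<Rightarrow> real"
  assumes RNP: "radon_nikodym_property TYPE('x)" and p: "1 \<le> p"
    and f: "f \<in> Hw" "\<And>\<phi>. 0 \<le> f \<phi>" "p_bounded_by p 1 f"
  obtains g where "g \<in> FBL p" "\<And>\<phi>. 0 \<le> g \<phi>" "p_bounded_by p 1 g" "\<And>\<phi>. f \<phi> \<le> g \<phi>"
proof -
  obtain M :: "'x measure" where M: "finite_measure M" "measure M (space M) = 1" "space M = cball 0 1"
    "\<And>y. (\<lambda>x. J x y) \<in> borel_measurable M"
    "\<And>y. f (predual_embedding y) powr p \<le> (\<integral>x. \<bar>J x y\<bar> powr p \<partial>M)"
    by (rule dominating_measure[OF p Hw_scaleR[OF f(1)] f(2,3)]) auto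
  interpret finite_measure M by (rule M(1))
  obtain h s where h: "simple_limit M s h" "\<And>i w. norm (s i w) \<le> 2" "\<And>w. norm (h w) \<le> 1"
    "\<And>y. AE w in M. J (h w) y = J w y"
    by (rule bounded_strong_density[OF M(1,3,4) RNP]) auto
  define g where "g = lp_functional M p h"
  have gF: "g \<in> FBL p" unfolding g_def by (rule lp_functional_in_FBL[OF p h(1,3,2)])
  have g0: "0 \<le> g \<phi>" for \<phi> by (simp add: g_def lp_functional_def)
  have "(\<integral>w. norm (h w) powr p \<partial>M) \<le> (\<integral>w. 1 \<partial>M)"
    using h(3) p by (intro integral_mono integrable_norm_powr[OF p h(1,3)]) (auto intro: powr_le1)
  then have "(\<integral>w. norm (h w) powr p \<partial>M) powr (1 / p) \<le> 1"
    using p M(2) by (simp add: powr_le1)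
  then have g1: "p_bounded_by p 1 g"
    unfolding g_def by (intro p_bounded_by_mono[OF p p_bounded_by_lp_functional[OF p h(1,3)]]) auto
  have le: "f (predual_embedding y) \<le> g (predual_embedding y)" for y
  proof -
    \<comment> \<open>With \<open>y\<close> fixed, the null set off which \<open>h\<close> and the
      identity have the same pairing may depend on \<open>y\<close>.\<close>
    have "(\<integral>x. \<bar>J x y\<bar> powr p \<partial>M) = (\<integral>w. \<bar>J (h w) y\<bar> powr p \<partial>M)"
    proof (rule integral_cong_AE)
      show "(\<lambda>x. \<bar>J x y\<bar> powr p) \<in> borel_measurable M" using M(4) by measurable
      show "(\<lambda>w. \<bar>J (h w) y\<bar> powr p) \<in> borel_measurable M"
        using borel_measurable_integrable[OF integrable_apply_powr[OF p h(1,3), of "predual_embedding y"]]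
        by simp
      show "AE x in M. \<bar>J x y\<bar> powr p = \<bar>J (h x) y\<bar> powr p" using h(4)[of y] by eventually_elim simp
    qed
    then have "(f (predual_embedding y) powr p) powr (1 / p) \<le> g (predual_embedding y)"
      using M(5)[of y] p by (simp add: g_def lp_functional_def powr_mono2)
    then show ?thesis using p f(2) by (simp add: powr_powr)
  qed
  have "g \<in> Hw" using gF by (simp add: FBL_def Hwp_def)
  from Hw_le_on_predual[OF f(1) this le] show thesis by (intro that[OF gF g0 g1])
qed

theorem theorem4p4:
  fixes J :: "'x::banach \<Rightarrow> ('y::banach \<Rightarrow>\<^sub>L real)"
    and p :: real
  assumes dual: "isometric_isomorphism J"
    and RNP: "radon_nikodym_property TYPE('x)"
    and p: "1 \<le> p"
  shows "(\<forall>f \<in> (Hwp p :: (('x \<Rightarrow>\<^sub>L real) \<Rightarrow> real) set).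
            (\<forall>\<phi>. 0 \<le> f \<phi>) \<and> p_norm p f \<le> 1 \<longrightarrow>
            (\<exists>g \<in> FBL p. (\<forall>\<phi>. 0 \<le> g \<phi>) \<and> p_norm p g \<le> 1 \<and> (\<forall>\<phi>. f \<phi> \<le> g \<phi>)))
         \<and> (Hwp p :: (('x \<Rightarrow>\<^sub>L real) \<Rightarrow> real) set) = Iwp p"
proof
  interpret dual_space J by standard (rule dual)
  have le1: "p_norm p f \<le> 1 \<longleftrightarrow> p_bounded_by p 1 f" for f :: "('x \<Rightarrow>\<^sub>L real) \<Rightarrow> real"
    using p_norm_le_iff[OF p, of 1 f] by simp
  show "\<forall>f \<in> (Hwp p :: (('x \<Rightarrow>\<^sub>L real) \<Rightarrow> real) set).
      (\<forall>\<phi>. 0 \<le> f \<phi>) \<and> p_norm p f \<le> 1 \<longrightarrow>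
      (\<exists>g \<in> FBL p. (\<forall>\<phi>. 0 \<le> g \<phi>) \<and> p_norm p g \<le> 1 \<and> (\<forall>\<phi>. f \<phi> \<le> g \<phi>))"
  proof (intro ballI impI)
    fix f :: "('x \<Rightarrow>\<^sub>L real) \<Rightarrow> real"
    assume "f \<in> Hwp p" "(\<forall>\<phi>. 0 \<le> f \<phi>) \<and> p_norm p f \<le> 1"
    then have f: "f \<in> Hw" "\<And>\<phi>. 0 \<le> f \<phi>" "p_bounded_by p 1 f" by (auto simp: Hwp_def le1)
    obtain g where "g \<in> FBL p" "\<And>\<phi>. 0 \<le> g \<phi>" "p_bounded_by p 1 g" "\<And>\<phi>. f \<phi> \<le> g \<phi>"
      by (rule FBL_majorant[OF RNP p f]) auto
    then show "\<exists>g \<in> FBL p. (\<forall>\<phi>. 0 \<le> g \<phi>) \<and> p_norm p g \<le> 1 \<and> (\<forall>\<phi>. f \<phi> \<le> g \<phi>)"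
      unfolding le1 by (intro bexI[of _ g]) auto
  qed
  show "(Hwp p :: (('x \<Rightarrow>\<^sub>L real) \<Rightarrow> real) set) = Iwp p"
  proof
    show "Iwp p \<subseteq> (Hwp p :: (('x \<Rightarrow>\<^sub>L real) \<Rightarrow> real) set)"
      unfolding Iwp_def using order_ideal_Hwp[OF p]
      by (intro Inter_lower) (auto simp: FBL_def)
    show "(Hwp p :: (('x \<Rightarrow>\<^sub>L real) \<Rightarrow> real) set) \<subseteq> Iwp p"
    proof
      fix f :: "('x \<Rightarrow>\<^sub>L real) \<Rightarrow> real" assume f: "f \<in> Hwp p"
      then have fHw: "f \<in> Hw" by (simp add: Hwp_def)
      obtain C where C: "0 \<le> C" "p_bounded_by p C f"
        using f p_norm_finite_iff[OF p, of f] unfolding Hwp_def by blast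
      define D where "D = C + 1"
      have D: "0 < D" "C \<le> D" using C by (auto simp: D_def)
      \<comment> \<open>The majorant exists for nonnegative functions of p-norm at most
        \<open>1\<close>, so \<open>\<bar>f\<bar>\<close> is rescaled; \<open>D = C + 1\<close>
        rules out division by zero. Multiplying the majorant by \<open>D\<close> stays in every
        ideal containing \<open>FBL p\<close>.\<close>
      define k where "k \<phi> = (1 / D) * \<bar>f \<phi>\<bar>" for \<phi>
      have kHw: "k \<in> Hw"
        using vector_sublattice_Hw abs_in_Hw[OF fHw]
        unfolding k_def vector_sublattice_def function_subspace_def by blast
      have "p_bounded_by p (\<bar>1 / D\<bar> * D) k"
        unfolding k_def using D by (intro p_bounded_by_scale[OF p] p_bounded_by_mono[OF p C(2)]) auto
      then have k1: "p_bounded_by p 1 k" using D by simp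
      have k0: "0 \<le> k \<phi>" for \<phi> using D by (simp add: k_def)
      obtain g where g: "g \<in> FBL p" "\<And>\<phi>. 0 \<le> g \<phi>" "\<And>\<phi>. k \<phi> \<le> g \<phi>"
        by (rule FBL_majorant[OF RNP p kHw k0 k1]) auto
      have le: "\<bar>f \<phi>\<bar> \<le> \<bar>D * g \<phi>\<bar>" for \<phi>
        using g(2,3)[of \<phi>] D by (simp add: k_def field_simps abs_mult)
      show "f \<in> Iwp p"
        unfolding Iwp_def
      proof (rule InterI, clarify)
        fix S :: "(('x \<Rightarrow>\<^sub>L real) \<Rightarrow> real) set"
        assume S: "order_ideal Hw S" "FBL p \<subseteq> S"
        have scale: "\<forall>c. \<forall>f\<in>S. (\<lambda>t. c * f t) \<in> S"
          using S(1) unfolding order_ideal_def function_subspace_def by (elim conjE)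
        have solid: "\<forall>f\<in>Hw. \<forall>g\<in>S. (\<forall>t. \<bar>f t\<bar> \<le> \<bar>g t\<bar>) \<longrightarrow> f \<in> S"
          using S(1) unfolding order_ideal_def by (elim conjE)
        have "(\<lambda>\<phi>. D * g \<phi>) \<in> S"
          by (rule scale[THEN spec, THEN bspec, OF subsetD[OF S(2) g(1)]])
        from solid[rule_format, OF fHw this le] show "f \<in> S" .
      qed
    qed
  qed
qed

end
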